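(* Suppose the project (as defined in the context) is threshold-indexable (i.e., both thresholdable and indexable) with Whittle index $\lambda^*(\cdot)$. Then for any $x\in\mathsf X$, $$F(x,z_2)-F(x,z_1)=\int_{(z_1,z_2]}\lambda^*(z)\,G(x,dz),\qquad -\infty<z_1<z_2<\infty.$$
   Context: Project model. $\mathsf X=\{x\in\mathbb R:\ell\le x\le u\}$ with $-\infty\le\ell<u\le\infty$; all sets and functions are Borel measurable. A project has state $X_t\in\mathsf X$ and action $A_t\in\{0,1\}$ ($1$ = active, $0$ = passive) at times $t=0,1,\dots$. When $(X_t,A_t)=(x,a)$ it yields reward $r(x,a)$, consumes $c(x,a)$ units of a resource, and $X_{t+1}\sim\kappa^a(x,\cdot)$, with $\kappa^0,\kappa^1$ Markov transition kernels on $\mathsf X$. The discount factor is $\beta\in[0,1)$. Standing assumption: for each $a\in\{0,1\}$, $r(\cdot,a)$ and $c(\cdot,a)$ are continuous on $\mathsf X$, $0\le c(x,0)<c(x,1)$ for all $x$, and there are a function $w:\mathsf X\to[1,\infty)$ and constants $M>0$, $\beta\le\gamma<1$ with $\max\{|r(x,a)|,c(x,a)\}\le M w(x)$ and $\beta\int w(y)\,\kappa^a(x,dy)\le\gamma w(x)$ for all $x,a$. Policies and metrics. $\Pi$ is the class of nonanticipative (history-dependent, possibly randomized) policies. $F(x,\pi)=\mathsf E_x^\pi[\sum_{t\ge0}\beta^t r(X_t,A_t)]$, $G(x,\pi)=\mathsf E_x^\pi[\sum_{t\ge0}\beta^t c(X_t,A_t)]$ with $X_0=x$. For $\lambda\in\mathbb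 R$, $V_\lambda(x,\pi)=F(x,\pi)-\lambda G(x,\pi)$ and $V^*_\lambda(x)=\sup_{\pi\in\Pi}V_\lambda(x,\pi)$. For $z\in\overline{\mathbb R}=\mathbb R\cup\{-\infty,\infty\}$ the $z$-policy takes $A_t=1$ iff $X_t>z$; its metrics are $F(x,z),G(x,z)$. Indexability and thresholdability. Let $V_\lambda^{\langle a,*\rangle}(x)=r(x,a)-\lambda c(x,a)+\beta\int V_\lambda^*(y)\,\kappa^a(x,dy)$ and $\Delta_\lambda(x)=V_\lambda^{\langle1,*\rangle}(x)-V_\lambda^{\langle0,*\rangle}(x)$. The project is indexable with Whittle index $\lambda^*:\mathsf X\to\mathbb R$ if $\operatorname{sgn}\Delta_\lambda(x)=\operatorname{sgn}(\lambda^*(x)-\lambda)$ for all $x\in\mathsf X$, $\lambda\in\mathbb R$, where $\operatorname{sgn}\in\{-1,0,1\}$. It is thresholdable if there is a map $z^*:\mathbb R\to\overline{\mathbb R}$ such that for all $x\in\mathsf X$, $\lambda\in\mathbb R$: $x\le z^*(\lambda)$ implies $\Delta_\lambda(x)\le0$, and $x\ge z^*(\lambda)$ implies $\Delta_\lambda(x)\ge0$. The integral is a Lebesgue–Stieltjes integral with respect to the function $z\mapsto G(x,z)$ on $\mathbb R$, for which $(a,b]$ has mass $G(x,b)-G(x,a)$. For $z\notin\mathsf X$, $\lambda^*$ is extended by $\lambda^*(z)=\lambda^*(\ell)$ for $z<\ell$ (if $\ell>-\infty$) and $\lambda^*(z)=\lambda^*(u)$ for $z>u$ (if $u<\infty$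).
   Formalization: The formal theorem additionally assumes that z ↦ G(x,z) has bounded variation on [z1,z2]; threshold-indexability alone does not imply this, and without it the Lebesgue–Stieltjes integral with respect to G(x,·) is undefined. *)

theory Defs
  imports "HOL-Probability.Probability"
begin

section \<open>Projects\<close>

text \<open>Action \<^term>\<open>True\<close> is active (1), \<^term>\<open>False\<close> is passive (0).\<close>

record project =
  lower_end :: ereal
  upper_end :: ereal
  reward :: "real \<Rightarrow> bool \<Rightarrow> real"
  cost :: "real \<Rightarrow> bool \<Rightarrow> real"
  kernel :: "bool \<Rightarrow> real \<Rightarrow> real measure"
  discount :: real

definition states :: "project \<Rightarrow> real set" where
  "states P = {x. lower_end P \<le> ereal x \<and> ereal x \<le> upper_end P}"

definition state_space :: "project \<Rightarrow> real measure" where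
  "state_space P = restrict_space borel (states P)"

definition stage_space :: "project \<Rightarrow> (real \<times> bool) measure" where
  "stage_space P = state_space P \<Otimes>\<^sub>M count_space UNIV"

text \<open>
  The drift condition on \<open>w\<close> is stated with the nonnegative integral, so that for a positive
  discount factor it includes the finiteness of \<open>\<integral>w d\<kappa>\<close>.
\<close>

definition is_project :: "project \<Rightarrow> bool" where
  "is_project P \<longleftrightarrow>
     lower_end P < upper_end P \<and>
     0 \<le> discount P \<and> discount P < 1 \<and>
     (\<forall>a. kernel P a \<in> state_space P \<rightarrow>\<^sub>M prob_algebra (state_space P)) \<and>
     (\<forall>a. continuous_on (states P) (\<lambda>x. reward P x a)) \<and>
     (\<forall>a. continuous_on (states P) (\<lambda>x. cost P x a)) \<and>
     (\<forall>x\<in>states P. 0 \<le> cost P x False \<and> cost P x False < cost P x True) \<and>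
     (\<exists>(w :: real \<Rightarrow> real) M \<gamma>.
        w \<in> borel_measurable (state_space P) \<and>
        M > 0 \<and> discount P \<le> \<gamma> \<and> \<gamma> < 1 \<and>
        (\<forall>x\<in>states P. 1 \<le> w x \<and>
           (\<forall>a. max \<bar>reward P x a\<bar> (cost P x a) \<le> M * w x \<and>
                ennreal (discount P) * (\<integral>\<^sup>+ y. ennreal (w y) \<partial>kernel P a x)
                  \<le> ennreal (\<gamma> * w x))))"


section \<open>Policies and metrics\<close>

text \<open>
  At time \<open>t\<close> a policy maps the past states and actions (times \<open>0, \<dots>, t - 1\<close>) and the current
  state to a probability distribution over actions.
\<close>

type_synonym policy = "nat \<Rightarrow> (nat \<Rightarrow> real \<times> bool) \<times> real \<Rightarrow> bool measure"

definition policies :: "project \<Rightarrow> policy set" where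
  "policies P = {\<pi>. \<forall>t. \<pi> t \<in>
     (Pi\<^sub>M {0..<t} (\<lambda>_. stage_space P) \<Otimes>\<^sub>M state_space P) \<rightarrow>\<^sub>M prob_algebra (count_space UNIV)}"

definition threshold_policy :: "ereal \<Rightarrow> policy" where
  "threshold_policy z = (\<lambda>t (h, y). return (count_space UNIV) (ereal y > z))"

text \<open>Conditional law of the state-action pair at time \<open>t\<close> given the history \<open>h\<close> before time \<open>t\<close>.\<close>

definition next_state ::
    "project \<Rightarrow> real \<Rightarrow> nat \<Rightarrow> (nat \<Rightarrow> real \<times> bool) \<Rightarrow> real measure" where
  "next_state P x t h = (case t of
       0 \<Rightarrow> return (state_space P) x
     | Suc s \<Rightarrow> kernel P (snd (h s)) (fst (h s)))"

definition stage_law ::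
    "project \<Rightarrow> real \<Rightarrow> policy \<Rightarrow> nat \<Rightarrow> (nat \<Rightarrow> real \<times> bool) \<Rightarrow> (real \<times> bool) measure" where
  "stage_law P x \<pi> t h =
     next_state P x t h \<bind> (\<lambda>y. \<pi> t (h, y) \<bind> (\<lambda>a. return (stage_space P) (y, a)))"

text \<open>The law of the whole state-action trajectory started at \<open>x\<close> (Ionescu-Tulcea).\<close>

definition trajectory_law :: "project \<Rightarrow> real \<Rightarrow> policy \<Rightarrow> (nat \<Rightarrow> real \<times> bool) measure" where
  "trajectory_law P x \<pi> =
     projective_family.lim UNIV
       (Ionescu_Tulcea.CI (stage_law P x \<pi>) (\<lambda>_. stage_space P)) (\<lambda>_. stage_space P)"

definition discounted_total ::
    "project \<Rightarrow> (real \<Rightarrow> bool \<Rightarrow> real) \<Rightarrow> real \<Rightarrow> policy \<Rightarrow> real" where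
  "discounted_total P f x \<pi> =
     (\<integral>\<omega>. (\<Sum>t. discount P ^ t * f (fst (\<omega> t)) (snd (\<omega> t))) \<partial>trajectory_law P x \<pi>)"

definition reward_metric :: "project \<Rightarrow> real \<Rightarrow> policy \<Rightarrow> real" where
  "reward_metric P = discounted_total P (reward P)"

definition cost_metric :: "project \<Rightarrow> real \<Rightarrow> policy \<Rightarrow> real" where
  "cost_metric P = discounted_total P (cost P)"

definition net_value :: "project \<Rightarrow> real \<Rightarrow> real \<Rightarrow> policy \<Rightarrow> real" where
  "net_value P lam x \<pi> = reward_metric P x \<pi> - lam * cost_metric P x \<pi>"

definition optimal_value :: "project \<Rightarrow> real \<Rightarrow> real \<Rightarrow> real" where
  "optimal_value P lam x = (SUP \<pi>\<in>policies P. net_value P lam x \<pi>)"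

abbreviation F_threshold :: "project \<Rightarrow> real \<Rightarrow> ereal \<Rightarrow> real" where
  "F_threshold P x z \<equiv> reward_metric P x (threshold_policy z)"

abbreviation G_threshold :: "project \<Rightarrow> real \<Rightarrow> ereal \<Rightarrow> real" where
  "G_threshold P x z \<equiv> cost_metric P x (threshold_policy z)"


section \<open>Indexability and thresholdability\<close>

definition action_value :: "project \<Rightarrow> real \<Rightarrow> bool \<Rightarrow> real \<Rightarrow> real" where
  "action_value P lam a x =
     reward P x a - lam * cost P x a
       + discount P * (\<integral>y. optimal_value P lam y \<partial>kernel P a x)"

definition action_gap :: "project \<Rightarrow> real \<Rightarrow> real \<Rightarrow> real" where
  "action_gap P lam x = action_value P lam True x - action_value P lam False x"

definition indexable_with :: "project \<Rightarrow> (real \<Rightarrow> real) \<Rightarrow> bool" where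
  "indexable_with P idx \<longleftrightarrow>
     (\<forall>x\<in>states P. \<forall>lam. sgn (action_gap P lam x) = sgn (idx x - lam))"

definition thresholdable :: "project \<Rightarrow> bool" where
  "thresholdable P \<longleftrightarrow>
     (\<exists>zs :: real \<Rightarrow> ereal. \<forall>x\<in>states P. \<forall>lam.
        (ereal x \<le> zs lam \<longrightarrow> action_gap P lam x \<le> 0) \<and>
        (zs lam \<le> ereal x \<longrightarrow> 0 \<le> action_gap P lam x))"

definition extend_index :: "project \<Rightarrow> (real \<Rightarrow> real) \<Rightarrow> real \<Rightarrow> real" where
  "extend_index P idx z =
     (if ereal z < lower_end P then idx (real_of_ereal (lower_end P))
      else if upper_end P < ereal z then idx (real_of_ereal (upper_end P))
      else idx z)"


section \<open>Lebesgue--Stieltjes integrals with respect to functions of bounded variation\<close>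

text \<open>
  Bounded variation is what makes the signed Lebesgue--Stieltjes measure of \<open>g\<close> exist. It has to
  be required of \<open>z \<mapsto> G(x, z)\<close>: where the index is constant, this function is in general
  neither monotone nor of bounded variation. Example: discount factor \<open>\<beta> > 1/2\<close>, states
  \<open>[0, 1]\<close>, \<open>r = 0\<close>, \<open>c(y, a) = a\<close>, and deterministic moves taking \<open>y = (2k + 1) / 2^n\<close>
  (with \<open>n \<ge> 1\<close>) to \<open>y - 1 / 2^(n+1)\<close> if active and to \<open>y + 1 / 2^(n+1)\<close> if passive, with all other
  states absorbing. The index is \<open>0\<close>, and for \<open>z\<close> in \<open>[0, 1)\<close> with binary digits \<open>b\<close>,
  \<open>G(1/2, z) = (\<Sum>n. \<beta>^n * (1 - b n))\<close>, which jumps by \<open>\<beta>^(n-1) * (2\<beta> - 1) / (1 - \<beta>)\<close>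
  at each of the \<open>2^(n-1)\<close> points \<open>(2k + 1) / 2^n\<close>.
\<close>

definition bounded_variation_on :: "real set \<Rightarrow> (real \<Rightarrow> real) \<Rightarrow> bool" where
  "bounded_variation_on S g \<longleftrightarrow>
     (\<exists>B. \<forall>(n::nat) p. (\<forall>i\<le>n. p i \<in> S) \<and> (\<forall>i<n. p i \<le> p (Suc i)) \<longrightarrow>
        (\<Sum>i<n. \<bar>g (p (Suc i)) - g (p i)\<bar>) \<le> B)"

text \<open>
  The integral of \<open>f\<close> over \<open>{a<..b}\<close> with respect to the signed measure assigning mass
  \<open>g t - g s\<close> to \<open>{s<..t}\<close>, written as a difference of two \<^const>\<open>interval_measure\<close>s.
  The value does not depend on the choice of the decomposition \<open>g = p - q\<close>.
\<close>

definition has_LS_integral ::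
    "(real \<Rightarrow> real) \<Rightarrow> (real \<Rightarrow> real) \<Rightarrow> real \<Rightarrow> real \<Rightarrow> real \<Rightarrow> bool" where
  "has_LS_integral f g a b I \<longleftrightarrow>
     (\<exists>p q. mono p \<and> mono q \<and>
        (\<forall>t. continuous (at_right t) p) \<and> (\<forall>t. continuous (at_right t) q) \<and>
        (\<forall>t\<in>{a..b}. g t = p t - q t) \<and>
        set_integrable (interval_measure p) {a<..b} f \<and>
        set_integrable (interval_measure q) {a<..b} f \<and>
        I = (LINT t:{a<..b}|interval_measure p. f t) - (LINT t:{a<..b}|interval_measure q. f t))"

end

theory Submission
  imports Defs
begin

text \<open>
  Thresholdability forces \<open>idx (z*(\<lambda>)) = \<lambda>\<close> whenever \<open>\<lambda>\<close> lies strictly between two values of the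
  index, so the index is nondecreasing with the intermediate value property, hence continuous.
  For \<open>\<lambda> = idx s\<close> the \<open>s\<close>-policy chooses a maximising action in every state, so it attains
  \<open>V*\<^sub>\<lambda>(x)\<close>. Comparing it with the \<open>t\<close>-policy, and then exchanging \<open>s\<close> and \<open>t\<close>, gives for \<open>s \<le> t\<close>

    \<open>idx t * (G(x,t) - G(x,s)) \<le> F(x,t) - F(x,s) \<le> idx s * (G(x,t) - G(x,s))\<close>.

  Since \<open>G(x,-)\<close> is right-continuous, it splits into two monotone right-continuous parts, and
  \<open>F(x,t) - F(x,s)\<close> differs from the integral of \<open>idx\<close> over \<open>(s,t]\<close> by at most a multiple of
  \<open>idx t - idx s\<close> times the increment of their sum. This difference is additive over intervals, so by
  uniform continuity of \<open>idx\<close> it is zero.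
\<close>

section \<open>Lebesgue--Stieltjes integrals and increments\<close>

text \<open>Subtracting the two bounds gives
  \<open>(idx t - idx s) * (G(x,t) - G(x,s)) \<le> 0\<close>. Across a strict increase of the index,
  \<open>G\<close> cannot increase; on a plateau \<open>G\<close> may move either way while
  \<open>F\<close> follows it with the constant factor. The integrator is therefore signed. The
  error is a product of two increments, hence of second order on fine partitions. The larger
  obstacle is that the optimal value is a supremum over history-dependent randomized policies,
  evaluated under the Ionescu-Tulcea law, so the optimality equation itself has to be proved. All
  metrics are reduced to one-time marginals of the trajectory law, on which moving to the next time
  is one application of the kernel. A fixed point of the Bellman operator, found by iteration in the
  norm weighted by \<open>w\<close>, is identified with the optimal value by a telescoping sum. For
  stationary policies, stage means are also powers of a transition operator evaluated at the
  starting state, which gives the right-continuity of \<open>G\<close>.\<close>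

lemma right_limits_of_mono:
  fixes f g :: "real \<Rightarrow> real"
  assumes f: "mono f" and g: "\<And>t. g t = Inf (f ` {t<..})"
  shows "mono g" and "(f \<longlongrightarrow> g t) (at_right t)" and "continuous (at_right t) g"
proof -
  have bdd: "bdd_below (f ` {t<..})" for t
    using f by (intro bdd_belowI2[of _ "f t"]) (auto simp: mono_def)
  have le: "g t \<le> f s" if "t < s" for t s
    unfolding g using that by (intro cInf_lower bdd) auto
  show mono: "mono g"
    unfolding g mono_def by (intro allI impI cInf_superset_mono bdd) auto
  have near: "\<exists>s>t. f s < c" if "g t < c" for t c
    using that bdd unfolding g by (subst (asm) cInf_less_iff) auto
  show "(f \<longlongrightarrow> g t) (at_right t)"
  proof (rule order_tendstoI)
    fix c assume "c < g t"
    then show "\<forall>\<^sub>F s in at_right t. c < f s"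
      using le by (intro eventually_at_rightI[of t "t + 1"]) (auto intro: less_le_trans)
  next
    fix c assume "g t < c"
    then obtain s where "t < s" "f s < c" using near by blast
    then show "\<forall>\<^sub>F s in at_right t. f s < c"
      using monoD[OF f] by (intro eventually_at_rightI[of t s]) (auto intro: le_less_trans less_imp_le)
  qed
  have "(g \<longlongrightarrow> g t) (at_right t)"
  proof (rule order_tendstoI)
    fix c assume "c < g t"
    then show "\<forall>\<^sub>F s in at_right t. c < g s"
      using mono by (intro eventually_at_rightI[of t "t + 1"]) (auto simp: mono_def intro: less_le_trans)
  next
    fix c assume "g t < c"
    then obtain s where "t < s" "f s < c" using near by blast
    then show "\<forall>\<^sub>F s in at_right t. g s < c"
      using le by (intro eventually_at_rightI[of t s]) (auto intro: le_less_trans)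
  qed
  then show "continuous (at_right t) g" by (simp add: continuous_within)
qed

text \<open>\<open>p\<close> is the total variation over \<open>{a..t}\<close> and
  \<open>q = p - g\<close>. Clamping the argument to \<open>{a..b}\<close> makes both parts constant
  outside the interval, so that they are monotone on the whole line, as
  \<open>has_LS_integral\<close> demands.\<close>

lemma Jordan_decomposition:
  fixes g :: "real \<Rightarrow> real"
  assumes bv: "bounded_variation_on {a..b} g" and "a \<le> b"
  obtains p q where "mono p" "mono q" "\<And>t. g (max a (min b t)) = p t - q t"
proof -
  define chain where "chain t n p \<longleftrightarrow> (\<forall>i\<le>n. p i \<in> {a..t}) \<and> (\<forall>i<n. p i \<le> p (Suc i))"
    for t and n :: nat and p :: "nat \<Rightarrow> real"
  define var where "var n p = (\<Sum>i<n. \<bar>g (p (Suc i)) - g (p i)\<bar>)" for n :: nat and p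
  define V where "V t = {var n p |n p. chain t n p}" for t
  define v where "v t = Sup (V t)" for t
  obtain B where B: "chain b n p \<Longrightarrow> var n p \<le> B" for n p
    using bv unfolding bounded_variation_on_def chain_def[abs_def] var_def[abs_def] by blast
  have bdd: "bdd_above (V t)" if "t \<le> b" for t
  proof (rule bdd_aboveI)
    fix y assume "y \<in> V t"
    then obtain n p where "y = var n p" "chain t n p" unfolding V_def by blast
    moreover from this(2) that have "chain b n p" by (auto simp: chain_def)
    ultimately show "y \<le> B" using B by simp
  qed
  have step: "v s + \<bar>g t - g s\<bar> \<le> v t" if st: "a \<le> s" "s \<le> t" "t \<le> b" for s t
  proof -
    have "var n p \<le> v t - \<bar>g t - g s\<bar>" if p: "chain s n p" for n p
    proof -
      \<comment> \<open>The chain is prolonged by \<open>s\<close> and \<open>t\<close>. Passing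
        through \<open>s\<close> isolates the increment \<open>\<bar>g t - g s\<bar>\<close> even
        when the chain stops before \<open>s\<close>; the connecting increment from
        \<open>p n\<close> to \<open>s\<close> is nonnegative and is dropped.\<close>
      define p' where "p' i = (if i \<le> n then p i else if i = Suc n then s else t)" for i
      have range: "p i \<in> {a..s}" if "i \<le> n" for i using p that by (auto simp: chain_def)
      have "p' i \<in> {a..t}" for i
        using range[of i] st by (auto simp: p'_def)
      moreover have "p' i \<le> p' (Suc i)" for i
        using range[of i] p st by (cases i n rule: linorder_cases) (auto simp: p'_def chain_def)
      ultimately have "chain t (n + 2) p'" by (simp add: chain_def)
      then have "var (n + 2) p' \<in> V t" unfolding V_def by blast
      then have "var (n + 2) p' \<le> v t"
        unfolding v_def using bdd st by (intro cSup_upper) auto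
      moreover have "var n p' = var n p"
        unfolding var_def p'_def by (intro sum.cong) auto
      then have "var (n + 2) p' = var n p + \<bar>g s - g (p n)\<bar> + \<bar>g t - g s\<bar>"
        by (simp add: var_def) (simp add: p'_def)
      ultimately show ?thesis by linarith
    qed
    \<comment> \<open>The one-point chain makes the set of variations nonempty, as bounding its
      supremum requires.\<close>
    moreover have "chain s 0 (\<lambda>_. s)" using st by (auto simp: chain_def)
    ultimately have "v s \<le> v t - \<bar>g t - g s\<bar>"
      unfolding v_def[of s] V_def by (intro cSup_least) blast+
    then show ?thesis by simp
  qed
  have mono: "v s \<le> v t" "v s - g s \<le> v t - g t" if "a \<le> s" "s \<le> t" "t \<le> b" for s t
    using step[OF that] by linarith+
  let ?c = "\<lambda>t. max a (min b t)"
  show thesis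
  proof
    show "mono (\<lambda>t. v (?c t))" "mono (\<lambda>t. v (?c t) - g (?c t))"
      by (rule monoI, rule mono; use assms(2) in simp)+
  qed simp
qed

text \<open>
  Passing to right limits in an arbitrary Jordan decomposition makes both parts right-continuous
  without showing that the variation function is.
\<close>

lemma right_continuous_Jordan_decomposition:
  fixes g :: "real \<Rightarrow> real"
  assumes bv: "bounded_variation_on {a..b} g" and ab: "a \<le> b"
    and rc: "\<And>t. a \<le> t \<Longrightarrow> t < b \<Longrightarrow> continuous (at_right t) g"
  obtains p q where "mono p" "mono q"
    "\<And>t. continuous (at_right t) p" "\<And>t. continuous (at_right t) q"
    "\<And>t. t \<in> {a..b} \<Longrightarrow> g t = p t - q t"
proof -
  obtain p q where pq: "mono p" "mono q" "\<And>t. g (max a (min b t)) = p t - q t"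
    using Jordan_decomposition[OF bv ab] by metis
  define P where "P t = Inf (p ` {t<..})" for t
  define Q where "Q t = Inf (q ` {t<..})" for t
  note P = right_limits_of_mono[OF pq(1) P_def] and Q = right_limits_of_mono[OF pq(2) Q_def]
  have "g t = P t - Q t" if t: "t \<in> {a..b}" for t
  proof -
    have "((\<lambda>s. p s - q s) \<longlongrightarrow> P t - Q t) (at_right t)"
      by (intro tendsto_diff P Q)
    moreover have "((\<lambda>s. p s - q s) \<longlongrightarrow> g t) (at_right t)"
    proof (cases "t < b")
      case True
      then have "(g \<longlongrightarrow> g t) (at_right t)" using rc t by (auto simp: continuous_within)
      moreover have "\<forall>\<^sub>F s in at_right t. g s = p s - q s"
        using True t by (intro eventually_at_rightI[of t b]) (auto simp: pq(3)[symmetric])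
      ultimately show ?thesis by (rule Lim_transform_eventually)
    next
      \<comment> \<open>Here \<open>t = b\<close>, and to the right of \<open>b\<close> the clamped
        function is constantly \<open>g b\<close>, so the limit comes from the clamping
        alone.\<close>
      case False
      then have "\<forall>\<^sub>F s in at_right t. g t = p s - q s"
        using t by (intro eventually_at_rightI[of t "t + 1"]) (auto simp: pq(3)[symmetric])
      then show ?thesis by (rule Lim_transform_eventually[OF tendsto_const])
    qed
    ultimately show ?thesis by (intro tendsto_unique[OF _ _ \<open>(_ \<longlongrightarrow> P t - Q t) _\<close>]) auto
  qed
  then show thesis using P Q that[of P Q] by blast
qed

text \<open>On \<open>{s<..t}\<close> the integrand lies between \<open>f s\<close> and
  \<open>f t\<close>, and the interval has mass \<open>p t - p s\<close>. Boundedness on a set of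
  finite mass also gives integrability.\<close>

lemma integral_interval_measure_bounds:
  fixes f p :: "real \<Rightarrow> real"
  assumes p: "mono p" "\<And>t. continuous (at_right t) p"
    and f: "mono f" and st: "s \<le> t"
  shows "set_integrable (interval_measure p) {s<..t} f"
    and "f s * (p t - p s) \<le> (LINT u:{s<..t}|interval_measure p. f u)"
    and "(LINT u:{s<..t}|interval_measure p. f u) \<le> f t * (p t - p s)"
proof -
  let ?M = "interval_measure p"
  have le: "p x \<le> p y" if "x \<le> y" for x y using p(1) that by (auto simp: mono_def)
  have em: "emeasure ?M {s<..t} = ennreal (p t - p s)"
    using emeasure_interval_measure_Ioc[OF st le p(2)] by simp
  have meas: "measure ?M {s<..t} = p t - p s"
    using measure_interval_measure_Ioc[OF st le p(2)] by simp
  have fm: "f \<in> borel_measurable ?M"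
    using borel_measurable_mono[OF f] by simp
  show i: "set_integrable ?M {s<..t} f"
    unfolding set_integrable_def
  proof (rule integrableI_bounded_set_indicator[OF _ fm])
    show "AE u in ?M. u \<in> {s<..t} \<longrightarrow> norm (f u) \<le> max \<bar>f s\<bar> \<bar>f t\<bar>"
    proof (intro AE_I2 impI)
      fix u assume "u \<in> {s<..t}"
      then have "f s \<le> f u" "f u \<le> f t" using f by (auto simp: mono_def)
      then show "norm (f u) \<le> max \<bar>f s\<bar> \<bar>f t\<bar>" by auto
    qed
  qed (simp_all add: em)
  have c: "set_integrable ?M {s<..t} (\<lambda>_. c)" "(LINT u:{s<..t}|?M. c) = c * (p t - p s)" for c :: real
    using em meas by (auto simp: set_integrable_def set_lebesgue_integral_def)
  show "f s * (p t - p s) \<le> (LINT u:{s<..t}|?M. f u)"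
    unfolding c(2)[symmetric] using f by (intro set_integral_mono c i) (auto simp: mono_def)
  show "(LINT u:{s<..t}|?M. f u) \<le> f t * (p t - p s)"
    unfolding c(2)[symmetric] using f by (intro set_integral_mono c i) (auto simp: mono_def)
qed

text \<open>On cells shorter than a modulus of uniform continuity the first factor is below
  \<open>e\<close>, while the increments of \<open>m\<close> telescope; the total change of
  \<open>H\<close> is thus at most \<open>e\<close> times that of \<open>m\<close>.\<close>

lemma constant_of_increment_bound:
  fixes H f m :: "real \<Rightarrow> real"
  assumes ab: "a \<le> b" and f: "continuous_on {a..b} f" and m: "mono m"
    and H: "\<And>s t. a \<le> s \<Longrightarrow> s \<le> t \<Longrightarrow> t \<le> b \<Longrightarrow> \<bar>H t - H s\<bar> \<le> (f t - f s) * (m t - m s)"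
  shows "H b = H a"
proof (rule ccontr)
  assume "H b \<noteq> H a"
  \<comment> \<open>Chosen so that \<open>e * (m b - m a)\<close> is at most half of
    \<open>\<bar>H b - H a\<bar>\<close>; the summand 1 covers the case
    \<open>m b = m a\<close>.\<close>
  define e where "e = \<bar>H b - H a\<bar> / (2 * (m b - m a + 1))"
  have m_le: "m s \<le> m t" if "s \<le> t" for s t using m that by (auto simp: mono_def)
  have e: "0 < e" using \<open>H b \<noteq> H a\<close> m_le[OF ab] by (auto simp: e_def)
  have "uniformly_continuous_on {a..b} f" by (intro compact_uniformly_continuous f) auto
  then obtain d where d: "0 < d"
    "\<And>s t. s \<in> {a..b} \<Longrightarrow> t \<in> {a..b} \<Longrightarrow> dist t s < d \<Longrightarrow> dist (f t) (f s) < e"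
    using e unfolding uniformly_continuous_on_def by metis
  obtain n :: nat where n: "(b - a) / d < n" using reals_Archimedean2 by blast
  have "0 \<le> (b - a) / d" using ab d(1) by simp
  then have n0: "0 < real n" using n by linarith
  define h where "h = (b - a) / n"
  have h: "0 \<le> h" "h < d" "n * h = b - a"
    using n n0 d(1) ab by (auto simp: h_def field_simps)
  have range: "a + k * h \<in> {a..b}" if "k \<le> n" for k :: nat
  proof -
    have "real k * h \<le> n * h" using that h by (intro mult_right_mono) auto
    then show ?thesis using h by auto
  qed
  have "\<bar>H (a + k * h) - H a\<bar> \<le> e * (m (a + k * h) - m a)" if "k \<le> n" for k :: nat
    using that
  proof (induction k)
    case (Suc k)
    let ?s = "a + k * h" and ?t = "a + Suc k * h"
    have st: "?s \<le> ?t" "?s \<in> {a..b}" "?t \<in> {a..b}" "dist ?t ?s < d"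
      using range[of k] range[of "Suc k"] Suc.prems h by (auto simp: dist_real_def algebra_simps)
    have "\<bar>H ?t - H ?s\<bar> \<le> (f ?t - f ?s) * (m ?t - m ?s)" using st by (intro H) auto
    also have "\<dots> \<le> e * (m ?t - m ?s)"
      using d(2)[OF st(2-4)] m_le[OF st(1)] by (intro mult_right_mono) (auto simp: dist_real_def)
    finally show ?case using Suc by (simp add: algebra_simps)
  qed simp
  from this[of n] have "\<bar>H b - H a\<bar> \<le> e * (m b - m a)" using h(3) by simp
  also have "\<dots> \<le> e * (m b - m a + 1)" using e by simp
  also have "\<dots> = \<bar>H b - H a\<bar> / 2" using m_le[OF ab] by (auto simp: e_def field_simps)
  finally show False using \<open>H b \<noteq> H a\<close> by simp
qed

text \<open>The increments of both integrals and of \<open>F\<close> are controlled by endpoint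
  values of \<open>f\<close> times increments of \<open>p\<close> and \<open>q\<close>. In the
  discrepancy \<open>H\<close> the leading terms cancel, and only products of increments
  remain.\<close>

lemma has_LS_integral_of_increment_bounds:
  fixes f F G :: "real \<Rightarrow> real"
  assumes ab: "a \<le> b" and cont: "continuous_on {a..b} f" and f: "mono f"
    and bv: "bounded_variation_on {a..b} G"
    and rc: "\<And>t. a \<le> t \<Longrightarrow> t < b \<Longrightarrow> continuous (at_right t) G"
    and lower: "\<And>s t. a \<le> s \<Longrightarrow> s \<le> t \<Longrightarrow> t \<le> b \<Longrightarrow> f t * (G t - G s) \<le> F t - F s"
    and upper: "\<And>s t. a \<le> s \<Longrightarrow> s \<le> t \<Longrightarrow> t \<le> b \<Longrightarrow> F t - F s \<le> f s * (G t - G s)"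
  shows "has_LS_integral f G a b (F b - F a)"
proof -
  obtain p q where p: "mono p" "\<And>t. continuous (at_right t) p"
    and q: "mono q" "\<And>t. continuous (at_right t) q"
    and G: "\<And>t. t \<in> {a..b} \<Longrightarrow> G t = p t - q t"
    using right_continuous_Jordan_decomposition[OF bv ab rc] by metis
  define I where "I r t = (LINT u:{a<..t}|interval_measure r. f u)" for r t
  have I_diff: "f s * (r t - r s) \<le> I r t - I r s" "I r t - I r s \<le> f t * (r t - r s)"
    if r: "mono r" "\<And>t. continuous (at_right t) r" and st: "a \<le> s" "s \<le> t" for r s t
  proof -
    note B = integral_interval_measure_bounds[OF r f]
    have "{a<..t} = {a<..s} \<union> {s<..t}" using st by auto
    then have "I r t = I r s + (LINT u:{s<..t}|interval_measure r. f u)"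
      unfolding I_def using B(1)[OF st(1)] B(1)[OF st(2)] by (simp add: set_integral_Un)
    then show "f s * (r t - r s) \<le> I r t - I r s" "I r t - I r s \<le> f t * (r t - r s)"
      using B(2,3)[OF st(2)] by auto
  qed
  define H where "H t = I p t - I q t - F t" for t
  \<comment> \<open>The factor 2 is slack: combining the bounds even leaves
    \<open>(f t - f s) * (q t - q s)\<close>. All that matters is that the second factor is the
    increment of a monotone function.\<close>
  have "\<bar>H t - H s\<bar> \<le> (f t - f s) * (2 * (p t + q t) - 2 * (p s + q s))"
    if st: "a \<le> s" "s \<le> t" "t \<le> b" for s t
  proof -
    have mono: "f s \<le> f t" "p s \<le> p t" "q s \<le> q t"
      using f p q st by (auto simp: mono_def)
    have "0 \<le> (f t - f s) * (p t - p s)" "0 \<le> (f t - f s) * (q t - q s)"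
      using mono by auto
    moreover have "f t * ((p t - q t) - (p s - q s)) \<le> F t - F s"
      "F t - F s \<le> f s * ((p t - q t) - (p s - q s))"
      using lower[OF st] upper[OF st] st by (auto simp: G)
    ultimately show ?thesis
      using I_diff[OF p st(1,2)] I_diff[OF q st(1,2)] unfolding H_def
      by (auto simp: abs_le_iff algebra_simps)
  qed
  moreover have "mono (\<lambda>t. 2 * (p t + q t))"
    using p q by (auto simp: mono_def intro!: add_mono)
  ultimately have "H b = H a"
    using constant_of_increment_bound[OF ab cont] by blast
  \<comment> \<open>At \<open>a\<close> both integrals range over the empty set, so
    \<open>H a = - F a\<close>.\<close>
  then have "F b - F a = I p b - I q b" by (simp add: H_def I_def set_lebesgue_integral_def)
  then show ?thesis
    unfolding has_LS_integral_def I_def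
    using p q G integral_interval_measure_bounds(1)[OF p f ab]
      integral_interval_measure_bounds(1)[OF q f ab] by blast
qed

section \<open>Laws of single stages\<close>

text \<open>More general than thresholds, because the policy that attains the optimal value at an
  arbitrary price comes from a measurable selector of maximising actions.\<close>

definition stationary_policy :: "(real \<Rightarrow> bool) \<Rightarrow> policy" where
  "stationary_policy \<sigma> = (\<lambda>t (h, y). return (count_space UNIV) (\<sigma> y))"

locale markov_project =
  fixes P :: project
  assumes kernel: "\<And>a. kernel P a \<in> state_space P \<rightarrow>\<^sub>M prob_algebra (state_space P)"
begin

lemma space_state_space [simp]: "space (state_space P) = states P"
  by (simp add: state_space_def space_restrict_space)

lemma space_stage_space [simp]: "space (stage_space P) = states P \<times> UNIV"
  by (simp add: stage_space_def space_pair_measure)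

lemma measurable_fst_stage [measurable]: "fst \<in> stage_space P \<rightarrow>\<^sub>M state_space P"
  by (simp add: stage_space_def)

lemma measurable_snd_stage [measurable]: "snd \<in> stage_space P \<rightarrow>\<^sub>M count_space UNIV"
  by (simp add: stage_space_def)

lemma measurable_stage_space:
  assumes [measurable]: "\<And>a. (\<lambda>y. f y a) \<in> state_space P \<rightarrow>\<^sub>M N"
  shows "(\<lambda>p. f (fst p) (snd p)) \<in> stage_space P \<rightarrow>\<^sub>M N"
  using measurable_compose_countable'[where f="\<lambda>a p. f (fst p) a" and g=snd and I=UNIV
      and M="stage_space P" and N=N]
  by simp

lemma kernel_stage: "(\<lambda>p. kernel P (snd p) (fst p)) \<in> stage_space P \<rightarrow>\<^sub>M prob_algebra (state_space P)"
  by (rule measurable_stage_space) (rule kernel)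

lemma kernelD:
  assumes "x \<in> states P"
  shows "prob_space (kernel P a x)" "sets (kernel P a x) = sets (state_space P)"
    "space (kernel P a x) = states P"
  using measurable_space[OF kernel, of x a] assms sets_eq_imp_space_eq[of "kernel P a x" "state_space P"]
  by (auto simp: space_prob_algebra)

lemma stationary_policy_in_policies:
  assumes [measurable]: "\<sigma> \<in> state_space P \<rightarrow>\<^sub>M count_space UNIV"
  shows "stationary_policy \<sigma> \<in> policies P"
  unfolding policies_def stationary_policy_def
  by (auto simp: split_beta' intro!: measurable_compose[OF _ measurable_return_prob_space])

lemma measurable_next_state:
  assumes x: "x \<in> states P"
  shows "next_state P x t \<in> Pi\<^sub>M {0..<t} (\<lambda>_. stage_space P) \<rightarrow>\<^sub>M prob_algebra (state_space P)"
proof (cases t)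
  case 0
  then show ?thesis
    using x measurable_space[OF measurable_return_prob_space, of x "state_space P"]
    by (simp add: next_state_def[abs_def])
next
  case (Suc s)
  have "(\<lambda>h. h s) \<in> Pi\<^sub>M {0..<Suc s} (\<lambda>_. stage_space P) \<rightarrow>\<^sub>M stage_space P"
    by (rule measurable_component_singleton) simp
  from measurable_compose[OF this kernel_stage] show ?thesis
    by (simp add: next_state_def[abs_def] Suc)
qed

lemma measurable_policy_stage:
  assumes "\<pi> \<in> policies P"
  shows "(\<lambda>p. \<pi> t p \<bind> (\<lambda>a. return (stage_space P) (snd p, a)))
     \<in> Pi\<^sub>M {0..<t} (\<lambda>_. stage_space P) \<Otimes>\<^sub>M state_space P \<rightarrow>\<^sub>M prob_algebra (stage_space P)"
proof (rule measurable_bind_prob_space2)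
  show "\<pi> t \<in> Pi\<^sub>M {0..<t} (\<lambda>_. stage_space P) \<Otimes>\<^sub>M state_space P \<rightarrow>\<^sub>M prob_algebra (count_space UNIV)"
    using assms by (auto simp: policies_def)
qed (auto simp: stage_space_def split_beta' intro!: measurable_compose[OF _ measurable_return_prob_space])

lemma measurable_stage_law:
  assumes x: "x \<in> states P" and \<pi>: "\<pi> \<in> policies P"
  shows "stage_law P x \<pi> t \<in> Pi\<^sub>M {0..<t} (\<lambda>_. stage_space P) \<rightarrow>\<^sub>M prob_algebra (stage_space P)"
  unfolding stage_law_def[abs_def]
  using measurable_policy_stage[OF \<pi>, of t]
  by (intro measurable_bind_prob_space2[OF measurable_next_state[OF x]]) (simp add: split_beta')

lemma stage_law_kernel:
  assumes x: "x \<in> states P" and \<pi>: "\<pi> \<in> policies P"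
    and h: "h \<in> space (Pi\<^sub>M {0..<t} (\<lambda>_. stage_space P))"
  shows "(\<lambda>y. \<pi> t (h, y) \<bind> (\<lambda>a. return (stage_space P) (y, a)))
     \<in> next_state P x t h \<rightarrow>\<^sub>M prob_algebra (stage_space P)"
proof -
  have "sets (next_state P x t h) = sets (state_space P)"
    using measurable_space[OF measurable_next_state[OF x] h] by (simp add: space_prob_algebra)
  moreover have "(\<lambda>y. (h, y)) \<in> state_space P \<rightarrow>\<^sub>M Pi\<^sub>M {0..<t} (\<lambda>_. stage_space P) \<Otimes>\<^sub>M state_space P"
    using h by simp
  from measurable_compose[OF this measurable_policy_stage[OF \<pi>]]
  have "(\<lambda>y. \<pi> t (h, y) \<bind> (\<lambda>a. return (stage_space P) (y, a)))
     \<in> state_space P \<rightarrow>\<^sub>M prob_algebra (stage_space P)" by simp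
  ultimately show ?thesis by (simp cong: measurable_cong_sets)
qed

text \<open>After projection to the state, the bind over the action averages a constant kernel with
  a probability measure, and disappears.\<close>

lemma distr_stage_law_fst:
  assumes x: "x \<in> states P" and \<pi>: "\<pi> \<in> policies P"
    and h: "h \<in> space (Pi\<^sub>M {0..<t} (\<lambda>_. stage_space P))"
  shows "distr (stage_law P x \<pi> t h) (state_space P) fst = next_state P x t h"
proof -
  have N: "prob_space (next_state P x t h)" "sets (next_state P x t h) = sets (state_space P)"
    using measurable_space[OF measurable_next_state[OF x] h] by (auto simp: space_prob_algebra)
  then have sp: "space (next_state P x t h) = states P" "states P \<noteq> {}"
    using sets_eq_imp_space_eq[OF N(2)] x by auto
  have "distr (stage_law P x \<pi> t h) (state_space P) fst =
    next_state P x t h \<bind> (\<lambda>y. distr (\<pi> t (h, y) \<bind> (\<lambda>a. return (stage_space P) (y, a))) (state_space P) fst)"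
    unfolding stage_law_def using sp
    by (intro distr_bind[OF measurable_prob_algebraD[OF stage_law_kernel[OF x \<pi> h]]]) auto
  also have "\<dots> = next_state P x t h \<bind> (\<lambda>y. return (state_space P) y)"
  proof (rule bind_cong[OF refl])
    fix y assume "y \<in> space (next_state P x t h)"
    then have y: "y \<in> states P" using sp by simp
    then have "(h, y) \<in> space (Pi\<^sub>M {0..<t} (\<lambda>_. stage_space P) \<Otimes>\<^sub>M state_space P)"
      using h by (simp add: space_pair_measure)
    then have \<pi>y: "prob_space (\<pi> t (h, y))" "sets (\<pi> t (h, y)) = sets (count_space UNIV)"
      using \<pi> measurable_space[of "\<pi> t" _ "prob_algebra (count_space UNIV)" "(h, y)"]
      by (auto simp: policies_def space_prob_algebra)
    have "distr (\<pi> t (h, y) \<bind> (\<lambda>a. return (stage_space P) (y, a))) (state_space P) fst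
        = \<pi> t (h, y) \<bind> (\<lambda>a. distr (return (stage_space P) (y, a)) (state_space P) fst)"
      using \<pi>y prob_space.not_empty[OF \<pi>y(1)] y
      by (intro distr_bind[where K="stage_space P"]) (auto simp: measurable_cong_sets[OF \<pi>y(2) refl]
          space_subprob_algebra intro!: prob_space_imp_subprob_space prob_space_return)
    also have "\<dots> = \<pi> t (h, y) \<bind> (\<lambda>a. return (state_space P) y)"
      using y by (simp add: distr_return)
    also have "\<dots> = return (state_space P) y"
      using \<pi>y y by (intro bind_const') (auto intro!: prob_space_imp_subprob_space prob_space_return)
    finally show "distr (\<pi> t (h, y) \<bind> (\<lambda>a. return (stage_space P) (y, a))) (state_space P) fst
        = return (state_space P) y" .
  qed
  also have "\<dots> = next_state P x t h"
    using N(2) by (metis bind_return' return_sets_cong)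
  finally show ?thesis .
qed

text \<open>Laws at single times suffice for the metrics once sum and expectation are exchanged, and
  they obey a one-step recursion in which the history no longer appears.\<close>

definition stage_marginal :: "real \<Rightarrow> policy \<Rightarrow> nat \<Rightarrow> (real \<times> bool) measure" where
  "stage_marginal x \<pi> t = distr (trajectory_law P x \<pi>) (stage_space P) (\<lambda>\<omega>. \<omega> t)"

lemma Ionescu_Tulcea_stage_law:
  assumes "x \<in> states P" "\<pi> \<in> policies P"
  shows "Ionescu_Tulcea (stage_law P x \<pi>) (\<lambda>_. stage_space P)"
proof (rule Ionescu_Tulcea.intro)
  fix t
  note m = measurable_stage_law[OF assms, of t]
  show "stage_law P x \<pi> t \<in> Pi\<^sub>M {0..<t} (\<lambda>_. stage_space P) \<rightarrow>\<^sub>M subprob_algebra (stage_space P)"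
    by (rule measurable_prob_algebraD[OF m])
  show "prob_space (stage_law P x \<pi> t h)" if "h \<in> space (Pi\<^sub>M {0..<t} (\<lambda>_. stage_space P))" for h
    using measurable_space[OF m that] by (simp add: space_prob_algebra)
qed

lemma sets_stage_marginal [simp, measurable_cong]: "sets (stage_marginal x \<pi> t) = sets (stage_space P)"
  by (simp add: stage_marginal_def)

lemma space_stage_marginal [simp]: "space (stage_marginal x \<pi> t) = states P \<times> UNIV"
  by (simp add: stage_marginal_def)

context
  fixes x \<pi>
  assumes x: "x \<in> states P" and \<pi>: "\<pi> \<in> policies P"
begin

interpretation IT: Ionescu_Tulcea "stage_law P x \<pi>" "\<lambda>_. stage_space P"
  by (rule Ionescu_Tulcea_stage_law[OF x \<pi>])

lemma sets_trajectory_law: "sets (trajectory_law P x \<pi>) = sets (Pi\<^sub>M UNIV (\<lambda>_. stage_space P))"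
  by (simp add: trajectory_law_def)

lemma measurable_trajectory_component:
  "(\<lambda>\<omega>. \<omega> t) \<in> trajectory_law P x \<pi> \<rightarrow>\<^sub>M stage_space P"
  unfolding measurable_cong_sets[OF sets_trajectory_law refl]
  by (rule measurable_component_singleton) simp

text \<open>The trajectory law is known through its finite projections, and \<open>IT.C 0 n\<close>
  is the law of the first \<open>n\<close> stages. The function \<open>\<lambda>_. undefined\<close>
  is the empty history, the only element of a product over no indices.\<close>

lemma stage_marginal_eq_distr_C:
  "stage_marginal x \<pi> t = distr (IT.C 0 (Suc t) (\<lambda>_. undefined)) (stage_space P) (\<lambda>h. h t)"
proof -
  let ?M = "\<lambda>_::nat. stage_space P" and ?C = "\<lambda>n. IT.C 0 n (\<lambda>_. undefined)"
  let ?n = "IT.up_to {t}"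
  \<comment> \<open>\<open>IT.up_to {t}\<close> is the length of the shortest initial segment of
    times that contains \<open>t\<close>.\<close>
  have n: "Suc t = ?n"
    using IT.up_to_less[of "{t}" t] IT.up_to_iff[of "{t}" "Suc t"] by simp
  have C: "sets (?C ?n) = sets (Pi\<^sub>M {0..<?n} ?M)" using IT.sets_C[of _ 0 ?n] by simp
  have comp: "(\<lambda>h. h t) \<in> Pi\<^sub>M {t} ?M \<rightarrow>\<^sub>M stage_space P"
    by (rule measurable_component_singleton) simp
  have "distr (distr (trajectory_law P x \<pi>) (Pi\<^sub>M {t} ?M) (\<lambda>h. restrict h {t})) (stage_space P) (\<lambda>h. h t)
      = distr (distr (?C ?n) (Pi\<^sub>M {t} ?M) (\<lambda>h. restrict h {t})) (stage_space P) (\<lambda>h. h t)"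
    using IT.distr_lim[of "{t}"] by (simp add: trajectory_law_def IT.CI_def)
  moreover have "(\<lambda>h. restrict h {t}) \<in> trajectory_law P x \<pi> \<rightarrow>\<^sub>M Pi\<^sub>M {t} ?M"
    by (intro measurable_restrict measurable_trajectory_component)
  moreover have "(\<lambda>h. restrict h {t}) \<in> ?C ?n \<rightarrow>\<^sub>M Pi\<^sub>M {t} ?M"
    unfolding measurable_cong_sets[OF C refl]
    using n by (intro measurable_restrict measurable_component_singleton) auto
  ultimately show ?thesis
    unfolding n stage_marginal_def by (simp add: distr_distr[OF comp] comp_def)
qed

text \<open>\<open>IT.eP t h\<close> writes a draw from the stage law into position \<open>t\<close>
  of the history \<open>h\<close>; reading that coordinate returns the draw.\<close>

lemma stage_marginal_eq_bind:
  "stage_marginal x \<pi> t = IT.C 0 t (\<lambda>_. undefined) \<bind> stage_law P x \<pi> t"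
proof -
  let ?M = "\<lambda>_::nat. stage_space P" and ?C = "\<lambda>n. IT.C 0 n (\<lambda>_. undefined)"
  have C: "sets (?C t) = sets (Pi\<^sub>M {0..<t} ?M)" using IT.sets_C[of _ 0 t] by simp
  have comp: "(\<lambda>h. h t) \<in> Pi\<^sub>M {0..<Suc t} ?M \<rightarrow>\<^sub>M stage_space P"
    by (rule measurable_component_singleton) simp
  have eP: "IT.eP t \<in> ?C t \<rightarrow>\<^sub>M subprob_algebra (Pi\<^sub>M {0..<Suc t} ?M)"
    unfolding measurable_cong_sets[OF C refl] by (rule IT.measurable_eP)
  have "stage_marginal x \<pi> t = ?C t \<bind> (\<lambda>h. distr (IT.eP t h) (stage_space P) (\<lambda>h. h t))"
    unfolding stage_marginal_eq_distr_C
    using distr_bind[OF eP _ comp] prob_space.not_empty[OF IT.prob_space_C[of "\<lambda>_. undefined" 0 t]] by simp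
  also have "\<dots> = ?C t \<bind> stage_law P x \<pi> t"
  proof (rule bind_cong[OF refl])
    fix h assume "h \<in> space (?C t)"
    then have h: "h \<in> space (Pi\<^sub>M {0..<t} ?M)" using sets_eq_imp_space_eq[OF C] by simp
    have upd: "fun_upd h t \<in> stage_law P x \<pi> t h \<rightarrow>\<^sub>M Pi\<^sub>M {0..<Suc t} ?M"
      unfolding measurable_cong_sets[OF IT.sets_P[OF h] refl]
      using h by (intro measurable_fun_upd[where J="{0..<t}"]) auto
    show "distr (IT.eP t h) (stage_space P) (\<lambda>h. h t) = stage_law P x \<pi> t h"
      unfolding IT.eP_def distr_distr[OF comp upd]
      by (simp add: comp_def distr_id2[OF IT.sets_P[OF h, symmetric]])
  qed
  finally show ?thesis .
qed

lemma distr_stage_marginal_0_fst: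
  "distr (stage_marginal x \<pi> 0) (state_space P) fst = return (state_space P) x"
proof -
  have u: "(\<lambda>_. undefined) \<in> space (Pi\<^sub>M {0..<0::nat} (\<lambda>_. stage_space P))" by (simp add: space_PiM)
  have "stage_marginal x \<pi> 0 = stage_law P x \<pi> 0 (\<lambda>_. undefined)"
    unfolding stage_marginal_eq_bind using IT.P[of 0] u
    by (simp add: bind_return[where N="stage_space P"])
  then show ?thesis
    using distr_stage_law_fst[OF x \<pi> u] by (simp add: next_state_def)
qed

text \<open>The action may depend on the whole history, yet the next state is drawn from the kernel
  at the last state-action pair. Integrating out the rest of the history closes the recursion on
  marginals.\<close>

lemma distr_stage_marginal_Suc_fst:
  "distr (stage_marginal x \<pi> (Suc t)) (state_space P) fst =
     stage_marginal x \<pi> t \<bind> (\<lambda>p. kernel P (snd p) (fst p))"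
proof -
  let ?M = "\<lambda>_::nat. stage_space P" and ?C = "IT.C 0 (Suc t) (\<lambda>_. undefined)"
  have C: "sets ?C = sets (Pi\<^sub>M {0..<Suc t} ?M)" using IT.sets_C[of _ 0 "Suc t"] by simp
  have ne: "space ?C \<noteq> {}"
    using prob_space.not_empty[OF IT.prob_space_C[of "\<lambda>_. undefined" 0 "Suc t"]] by simp
  have law: "stage_law P x \<pi> (Suc t) \<in> ?C \<rightarrow>\<^sub>M subprob_algebra (stage_space P)"
    unfolding measurable_cong_sets[OF C refl] by (rule IT.P)
  have "distr (stage_marginal x \<pi> (Suc t)) (state_space P) fst
      = ?C \<bind> (\<lambda>h. distr (stage_law P x \<pi> (Suc t) h) (state_space P) fst)"
    unfolding stage_marginal_eq_bind by (rule distr_bind[OF law ne measurable_fst_stage])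
  also have "\<dots> = ?C \<bind> (\<lambda>h. kernel P (snd (h t)) (fst (h t)))"
    using distr_stage_law_fst[OF x \<pi>] sets_eq_imp_space_eq[OF C]
    by (intro bind_cong refl) (simp add: next_state_def)
  also have "\<dots> = stage_marginal x \<pi> t \<bind> (\<lambda>p. kernel P (snd p) (fst p))"
    unfolding stage_marginal_eq_distr_C
  proof (rule bind_distr[symmetric, OF _ measurable_prob_algebraD[OF kernel_stage] ne])
    show "(\<lambda>h. h t) \<in> ?C \<rightarrow>\<^sub>M stage_space P"
      unfolding measurable_cong_sets[OF C refl] by (rule measurable_component_singleton) simp
  qed
  finally show ?thesis .
qed

end

text \<open>Given any history and state \<open>y\<close>, the action law is a point mass at
  \<open>\<sigma> y\<close>. Under integrals this replaces the random action by a function of the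
  state.\<close>

lemma AE_stage_marginal_stationary:
  assumes x: "x \<in> states P" and \<sigma>[measurable]: "\<sigma> \<in> state_space P \<rightarrow>\<^sub>M count_space UNIV"
  shows "AE p in stage_marginal x (stationary_policy \<sigma>) t. snd p = \<sigma> (fst p)"
proof -
  let ?\<pi> = "stationary_policy \<sigma>"
  have \<pi>: "?\<pi> \<in> policies P" by (rule stationary_policy_in_policies) fact
  interpret IT: Ionescu_Tulcea "stage_law P x ?\<pi>" "\<lambda>_. stage_space P"
    by (rule Ionescu_Tulcea_stage_law[OF x \<pi>])
  let ?C = "IT.C 0 t (\<lambda>_. undefined)"
  have C: "sets ?C = sets (Pi\<^sub>M {0..<t} (\<lambda>_. stage_space P))" using IT.sets_C[of _ 0 t] by simp
  have law: "stage_law P x ?\<pi> t \<in> ?C \<rightarrow>\<^sub>M subprob_algebra (stage_space P)"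
    unfolding measurable_cong_sets[OF C refl] by (rule IT.P)
  have pred: "Measurable.pred (stage_space P) (\<lambda>p. snd p = \<sigma> (fst p))" by measurable
  have *: "AE p in stage_law P x ?\<pi> t h. snd p = \<sigma> (fst p)" if "h \<in> space ?C" for h
  proof -
    have h: "h \<in> space (Pi\<^sub>M {0..<t} (\<lambda>_. stage_space P))"
      using that sets_eq_imp_space_eq[OF C] by simp
    have sp: "space (next_state P x t h) = states P"
      using measurable_space[OF measurable_next_state[OF x] h]
        sets_eq_imp_space_eq[of "next_state P x t h" "state_space P"] by (simp add: space_prob_algebra)
    have *: "AE p in ?\<pi> t (h, y) \<bind> (\<lambda>a. return (stage_space P) (y, a)). snd p = \<sigma> (fst p)"
      if y: "y \<in> states P" for y
    proof -
      have eq: "?\<pi> t (h, y) \<bind> (\<lambda>a. return (stage_space P) (y, a)) = return (stage_space P) (y, \<sigma> y)"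
        unfolding stationary_policy_def using y
        by (simp add: bind_return[where N="stage_space P"] space_subprob_algebra prob_space_imp_subprob_space
            prob_space_return)
      show ?thesis unfolding eq using y by (subst AE_return[OF _ pred]) auto
    qed
    show ?thesis
      unfolding stage_law_def AE_bind[OF measurable_prob_algebraD[OF stage_law_kernel[OF x \<pi> h]] pred]
      by (rule AE_I2, rule *) (simp add: sp)
  qed
  show ?thesis
    unfolding stage_marginal_eq_bind[OF x \<pi>] AE_bind[OF law pred] by (rule AE_I2) (rule *)
qed

end

section \<open>Weighted supremum norms and verification\<close>

text \<open>Rewards and costs do not occur here: the estimates serve net rewards, value functions
  and their iterates alike, all of them bounded by a multiple of \<open>w\<close>.\<close>

locale weighted_project = markov_project +
  fixes w :: "real \<Rightarrow> real" and \<gamma> :: real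
  assumes discount_nonneg: "0 \<le> discount P"
    and discount_le: "discount P \<le> \<gamma>" and \<gamma>_less_1: "\<gamma> < 1"
    and measurable_w [measurable]: "w \<in> borel_measurable (state_space P)"
    and w_ge_1: "\<And>y. y \<in> states P \<Longrightarrow> 1 \<le> w y"
    and drift: "\<And>y a. y \<in> states P \<Longrightarrow>
      ennreal (discount P) * (\<integral>\<^sup>+ z. ennreal (w z) \<partial>kernel P a y) \<le> ennreal (\<gamma> * w y)"
begin

lemma \<gamma>_nonneg: "0 \<le> \<gamma>"
  using discount_nonneg discount_le by linarith

lemma w_nonneg: "y \<in> states P \<Longrightarrow> 0 \<le> w y"
  using w_ge_1[of y] by linarith

text \<open>Membership in the ball of radius \<open>C\<close> of the weighted supremum norm. The
  radius stays explicit because geometric rates in \<gamma> are read off from it.\<close>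

definition dominated :: "real \<Rightarrow> (real \<Rightarrow> real) \<Rightarrow> bool" where
  "dominated C u \<longleftrightarrow> u \<in> borel_measurable (state_space P) \<and> (\<forall>y\<in>states P. \<bar>u y\<bar> \<le> C * w y)"

definition stage_dominated :: "real \<Rightarrow> (real \<Rightarrow> bool \<Rightarrow> real) \<Rightarrow> bool" where
  "stage_dominated C g \<longleftrightarrow> (\<forall>a. dominated C (\<lambda>y. g y a))"

text \<open>
  The factor \<open>\<beta>\<close> is kept inside: for \<open>\<beta> = 0\<close> the drift condition allows \<open>\<integral>w d\<kappa> = \<infinity>\<close>, and the
  product is then \<open>0\<close> whatever the (possibly junk) integral is. The same holds for \<open>stage_mean\<close> below.
\<close>

definition transition :: "bool \<Rightarrow> (real \<Rightarrow> real) \<Rightarrow> real \<Rightarrow> real" where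
  "transition a u y = discount P * (\<integral>z. u z \<partial>kernel P a y)"

lemma dominatedD:
  assumes "dominated C u"
  shows "u \<in> borel_measurable (state_space P)" "y \<in> states P \<Longrightarrow> \<bar>u y\<bar> \<le> C * w y"
  using assms by (auto simp: dominated_def)

lemma dominated_constant_nonneg:
  assumes "dominated C u" "y \<in> states P"
  shows "0 \<le> C"
proof -
  have "0 \<le> C * w y" using dominatedD(2)[OF assms] by linarith
  then show ?thesis using w_ge_1[OF assms(2)] by (simp add: zero_le_mult_iff)
qed

lemma dominated_diff:
  assumes "dominated C u" "dominated D v"
  shows "dominated (C + D) (\<lambda>y. u y - v y)"
  using assms by (auto simp: dominated_def algebra_simps intro: order_trans[OF abs_triangle_ineq4 add_mono])

lemma dominated_add:
  assumes "dominated C u" "dominated D v"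
  shows "dominated (C + D) (\<lambda>y. u y + v y)"
  using assms by (auto simp: dominated_def algebra_simps intro: order_trans[OF abs_triangle_ineq add_mono])

lemma dominated_abs: "dominated C u \<Longrightarrow> dominated C (\<lambda>y. \<bar>u y\<bar>)"
  by (auto simp: dominated_def)

lemma dominated_cmult: "dominated C u \<Longrightarrow> dominated (\<bar>k\<bar> * C) (\<lambda>y. k * u y)"
  by (auto simp: dominated_def abs_mult mult.assoc mult_left_mono)

lemma dominated_weight: "0 \<le> C \<Longrightarrow> dominated C (\<lambda>y. C * w y)"
  using w_nonneg by (auto simp: dominated_def)

lemma dominated_action:
  assumes "stage_dominated C g" "\<sigma> \<in> state_space P \<rightarrow>\<^sub>M count_space UNIV"
  shows "dominated C (\<lambda>y. g y (\<sigma> y))"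
proof -
  have "(\<lambda>y. g y (\<sigma> y)) \<in> borel_measurable (state_space P)"
    using assms by (intro measurable_compose_countable'[where f="\<lambda>a y. g y a" and g=\<sigma> and I=UNIV])
      (auto simp: stage_dominated_def dominated_def)
  then show ?thesis using assms by (auto simp: stage_dominated_def dominated_def)
qed

lemma integrable_dominated:
  assumes M: "sets M = sets (state_space P)" "(\<integral>\<^sup>+ z. ennreal (w z) \<partial>M) < \<infinity>" and u: "dominated C u"
  shows "integrable M u"
proof (rule Bochner_Integration.integrable_bound)
  have sp: "space M = states P" using sets_eq_imp_space_eq[OF M(1)] by simp
  show "integrable M (\<lambda>z. C * w z)"
    using M(2) w_nonneg sp measurable_w
    by (intro integrable_mult_right integrableI_nonneg) (auto simp: measurable_cong_sets[OF M(1) refl])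
  show "u \<in> borel_measurable M"
    using dominatedD(1)[OF u] by (simp add: measurable_cong_sets[OF M(1) refl])
  show "AE z in M. norm (u z) \<le> norm (C * w z)"
    using dominatedD(2)[OF u] sp by (intro AE_I2) (auto intro: order_trans[OF _ abs_ge_self])
qed

lemma kernel_weight_finite:
  assumes "discount P \<noteq> 0" "y \<in> states P"
  shows "(\<integral>\<^sup>+ z. ennreal (w z) \<partial>kernel P a y) < \<infinity>"
proof (rule ccontr)
  assume "\<not> ?thesis"
  then have "(\<integral>\<^sup>+ z. ennreal (w z) \<partial>kernel P a y) = \<infinity>" by (simp add: less_top[symmetric])
  then show False
    using drift[OF assms(2), of a] assms(1) discount_nonneg
    by (simp add: ennreal_mult_top top_unique)
qed

lemma integrable_kernel:
  assumes "discount P \<noteq> 0" "y \<in> states P" "dominated C u"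
  shows "integrable (kernel P a y) u"
  using assms by (intro integrable_dominated kernelD kernel_weight_finite)

lemma transition_weight_le:
  assumes "y \<in> states P"
  shows "transition a w y \<le> \<gamma> * w y"
proof (cases "discount P = 0")
  case True
  then show ?thesis using assms \<gamma>_nonneg w_nonneg by (simp add: transition_def)
next
  case False
  have "integrable (kernel P a y) w"
    using integrable_kernel[OF False assms, of 1 w] dominated_weight[of 1] by simp
  then have "(\<integral>\<^sup>+ z. ennreal (w z) \<partial>kernel P a y) = ennreal (\<integral>z. w z \<partial>kernel P a y)"
    using w_nonneg kernelD(3)[OF assms] by (intro nn_integral_eq_integral AE_I2) auto
  then have "ennreal (transition a w y) \<le> ennreal (\<gamma> * w y)"
    using drift[OF assms, of a] discount_nonneg by (simp add: transition_def ennreal_mult')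
  then show ?thesis using \<gamma>_nonneg w_nonneg[OF assms] by (simp add: ennreal_le_iff)
qed

lemma transition_diff:
  assumes "dominated C u" "dominated D v" "y \<in> states P"
  shows "transition a (\<lambda>z. u z - v z) y = transition a u y - transition a v y"
  using assms integrable_kernel[of y C u a] integrable_kernel[of y D v a]
  by (cases "discount P = 0") (auto simp: transition_def algebra_simps)

text \<open>Bounding \<open>\<bar>u\<bar>\<close> by \<open>C * w\<close> under the integral and
  applying the drift condition shrinks the weighted norm by the factor \<gamma>.\<close>

lemma abs_transition_le:
  assumes u: "dominated C u" and y: "y \<in> states P"
  shows "\<bar>transition a u y\<bar> \<le> C * \<gamma> * w y"
proof -
  have C: "0 \<le> C" by (rule dominated_constant_nonneg[OF u y])
  have "\<bar>transition a u y\<bar> \<le> C * transition a w y"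
  proof (cases "discount P = 0")
    case False
    have w: "integrable (kernel P a y) w"
      using integrable_kernel[OF False y, of 1 w] dominated_weight[of 1] by simp
    have "\<bar>\<integral>z. u z \<partial>kernel P a y\<bar> \<le> (\<integral>z. \<bar>u z\<bar> \<partial>kernel P a y)"
      by (rule integral_abs_bound)
    also have "\<dots> \<le> (\<integral>z. C * w z \<partial>kernel P a y)"
      using integrable_kernel[OF False y u] w dominatedD(2)[OF u] kernelD(3)[OF y]
      by (intro integral_mono) auto
    finally show ?thesis
      using mult_left_mono[OF _ discount_nonneg] discount_nonneg
      by (simp add: transition_def abs_mult mult.left_commute[of C])
  qed (simp add: transition_def)
  also have "\<dots> \<le> C * (\<gamma> * w y)" by (intro mult_left_mono transition_weight_le y C)
  finally show ?thesis by (simp add: mult.assoc)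
qed

lemma stage_dominated_transition:
  assumes u: "dominated C u"
  shows "stage_dominated (C * \<gamma>) (\<lambda>y a. transition a u y)"
proof -
  have "(\<lambda>y. \<integral>z. u z \<partial>kernel P a y) \<in> borel_measurable (state_space P)" for a
    by (rule measurable_compose[OF measurable_prob_algebraD[OF kernel]
          integral_measurable_subprob_algebra[OF dominatedD(1)[OF u]]])
  then show ?thesis
    using abs_transition_le[OF u] by (auto simp: stage_dominated_def dominated_def transition_def[abs_def])
qed

lemma transition_tendsto:
  assumes u: "\<And>n. dominated C (u n)" and v: "dominated D v"
    and lim: "\<And>z. z \<in> states P \<Longrightarrow> (\<lambda>n. u n z) \<longlonglongrightarrow> v z" and y: "y \<in> states P"
  shows "(\<lambda>n. transition a (u n) y) \<longlonglongrightarrow> transition a v y"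
proof (cases "discount P = 0")
  case False
  have "0 \<le> C" by (rule dominated_constant_nonneg[OF u y])
  have M: "f \<in> borel_measurable (kernel P a y) \<longleftrightarrow> f \<in> borel_measurable (state_space P)" for f :: "real \<Rightarrow> real"
    using measurable_cong_sets[OF kernelD(2)[OF y] refl] by auto
  have "(\<lambda>n. \<integral>z. u n z \<partial>kernel P a y) \<longlonglongrightarrow> (\<integral>z. v z \<partial>kernel P a y)"
  proof (rule integral_dominated_convergence)
    show "integrable (kernel P a y) (\<lambda>z. C * w z)"
      by (rule integrable_kernel[OF False y dominated_weight]) fact
    show "AE z in kernel P a y. (\<lambda>n. u n z) \<longlonglongrightarrow> v z"
      using lim kernelD(3)[OF y] by (intro AE_I2) auto
    show "AE z in kernel P a y. norm (u n z) \<le> C * w z" for n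
      using dominatedD(2)[OF u] kernelD(3)[OF y] by (intro AE_I2) auto
  qed (use u v in \<open>auto simp: M dominated_def\<close>)
  then show ?thesis unfolding transition_def by (intro tendsto_intros)
qed (simp add: transition_def)

section \<open>Discounted means of single stages under an arbitrary policy\<close>

definition stage_mean :: "real \<Rightarrow> policy \<Rightarrow> nat \<Rightarrow> (real \<Rightarrow> bool \<Rightarrow> real) \<Rightarrow> real" where
  "stage_mean x \<pi> t g = discount P ^ t * (\<integral>p. g (fst p) (snd p) \<partial>stage_marginal x \<pi> t)"

lemma stage_mean_eq_0: "discount P ^ t = 0 \<Longrightarrow> stage_mean x \<pi> t g = 0"
  by (simp add: stage_mean_def del: power_eq_0_iff)

lemma measurable_stage_dominated:
  "stage_dominated C g \<Longrightarrow> (\<lambda>p. g (fst p) (snd p)) \<in> borel_measurable (stage_space P)"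
  by (intro measurable_stage_space) (auto simp: stage_dominated_def dominated_def)

context
  fixes x \<pi>
  assumes x: "x \<in> states P" and \<pi>: "\<pi> \<in> policies P"
begin

lemma nn_integral_stage_marginal_Suc:
  assumes u: "u \<in> borel_measurable (state_space P)"
  shows "(\<integral>\<^sup>+ p. u (fst p) \<partial>stage_marginal x \<pi> (Suc t)) =
    (\<integral>\<^sup>+ p. (\<integral>\<^sup>+ z. u z \<partial>kernel P (snd p) (fst p)) \<partial>stage_marginal x \<pi> t)"
proof -
  have "(\<integral>\<^sup>+ p. u (fst p) \<partial>stage_marginal x \<pi> (Suc t))
      = (\<integral>\<^sup>+ z. u z \<partial>distr (stage_marginal x \<pi> (Suc t)) (state_space P) fst)"
    using u by (intro nn_integral_distr[symmetric]) auto
  also have "\<dots> = (\<integral>\<^sup>+ p. (\<integral>\<^sup>+ z. u z \<partial>kernel P (snd p) (fst p)) \<partial>stage_marginal x \<pi> t)"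
    unfolding distr_stage_marginal_Suc_fst[OF x \<pi>]
    by (rule nn_integral_bind[OF u])
      (simp add: measurable_cong_sets[OF sets_stage_marginal refl] measurable_prob_algebraD[OF kernel_stage])
  finally show ?thesis .
qed

text \<open>The drift condition, applied inside the integral, contributes one factor \<gamma> per
  stage. The bound is stated in \<open>ennreal\<close> because finiteness of these integrals is
  itself deduced from it.\<close>

lemma stage_weight_le:
  "ennreal (discount P ^ t) * (\<integral>\<^sup>+ p. ennreal (w (fst p)) \<partial>stage_marginal x \<pi> t) \<le> ennreal (\<gamma> ^ t * w x)"
proof (induction t)
  case 0
  have "(\<integral>\<^sup>+ p. ennreal (w (fst p)) \<partial>stage_marginal x \<pi> 0)
      = (\<integral>\<^sup>+ z. ennreal (w z) \<partial>distr (stage_marginal x \<pi> 0) (state_space P) fst)"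
    by (intro nn_integral_distr[symmetric]) auto
  then show ?case using x by (simp add: distr_stage_marginal_0_fst[OF x \<pi>] nn_integral_return)
next
  case (Suc t)
  let ?\<mu> = "stage_marginal x \<pi> t" and ?b = "ennreal (discount P)"
  have meas: "(\<lambda>p. \<integral>\<^sup>+ z. ennreal (w z) \<partial>kernel P (snd p) (fst p)) \<in> borel_measurable ?\<mu>"
    unfolding measurable_cong_sets[OF sets_stage_marginal refl]
    by (rule measurable_compose[OF measurable_prob_algebraD[OF kernel_stage]
          nn_integral_measurable_subprob_algebra]) simp
  have "ennreal (discount P ^ Suc t) * (\<integral>\<^sup>+ p. ennreal (w (fst p)) \<partial>stage_marginal x \<pi> (Suc t))
      = ?b ^ t * (\<integral>\<^sup>+ p. ?b * (\<integral>\<^sup>+ z. ennreal (w z) \<partial>kernel P (snd p) (fst p)) \<partial>?\<mu>)"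
    using discount_nonneg meas
    by (subst nn_integral_stage_marginal_Suc) (auto simp: nn_integral_cmult ennreal_power ennreal_mult ac_simps)
  also have "\<dots> \<le> ?b ^ t * (\<integral>\<^sup>+ p. ennreal (\<gamma> * w (fst p)) \<partial>?\<mu>)"
    using drift by (intro mult_left_mono nn_integral_mono) auto
  also have "\<dots> = ennreal \<gamma> * (ennreal (discount P ^ t) * (\<integral>\<^sup>+ p. ennreal (w (fst p)) \<partial>?\<mu>))"
    using discount_nonneg \<gamma>_nonneg
    by (simp add: ennreal_mult' nn_integral_cmult measurable_cong_sets[OF sets_stage_marginal refl]
        ennreal_power mult.left_commute)
  also have "\<dots> \<le> ennreal \<gamma> * ennreal (\<gamma> ^ t * w x)"
    by (intro mult_left_mono Suc) auto
  also have "\<dots> = ennreal (\<gamma> ^ Suc t * w x)"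
    using \<gamma>_nonneg by (simp add: ennreal_mult'[symmetric] mult.assoc)
  finally show ?case .
qed

lemma stage_weight_finite:
  assumes "discount P ^ t \<noteq> 0"
  shows "(\<integral>\<^sup>+ p. ennreal (w (fst p)) \<partial>stage_marginal x \<pi> t) < \<infinity>"
proof (rule ccontr)
  assume "\<not> ?thesis"
  then have "(\<integral>\<^sup>+ p. ennreal (w (fst p)) \<partial>stage_marginal x \<pi> t) = \<infinity>" by (simp add: less_top[symmetric])
  moreover have "0 < discount P ^ t" 
    by (rule order.not_eq_order_implies_strict[OF assms[symmetric] zero_le_power[OF discount_nonneg]])
  moreover have "ennreal b * \<infinity> = \<infinity>" if "0 < b" for b
    using that by (simp add: ennreal_mult_top)
  ultimately show False
    using stage_weight_le[of t] by (metis ennreal_less_top infinity_ennreal_def not_less)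
qed

lemma integrable_stage_weight:
  assumes "discount P ^ t \<noteq> 0"
  shows "integrable (stage_marginal x \<pi> t) (\<lambda>p. w (fst p))"
  using stage_weight_finite[OF assms] w_nonneg
  by (intro integrableI_nonneg) (auto simp: measurable_cong_sets[OF sets_stage_marginal refl])

lemma stage_mean_weight_le: "stage_mean x \<pi> t (\<lambda>y a. w y) \<le> \<gamma> ^ t * w x"
proof (cases "discount P ^ t = 0")
  case True
  then show ?thesis using \<gamma>_nonneg w_nonneg[OF x] by (simp add: stage_mean_eq_0 del: power_eq_0_iff)
next
  case False
  have "(\<integral>\<^sup>+ p. ennreal (w (fst p)) \<partial>stage_marginal x \<pi> t)
      = ennreal (\<integral>p. w (fst p) \<partial>stage_marginal x \<pi> t)"
    using w_nonneg by (intro nn_integral_eq_integral integrable_stage_weight False AE_I2) auto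
  then have "ennreal (stage_mean x \<pi> t (\<lambda>y a. w y)) \<le> ennreal (\<gamma> ^ t * w x)"
    using stage_weight_le[of t] discount_nonneg by (simp add: stage_mean_def ennreal_mult')
  then show ?thesis using \<gamma>_nonneg w_nonneg[OF x] by (simp add: ennreal_le_iff)
qed

lemma integrable_stage_marginal:
  assumes "discount P ^ t \<noteq> 0" and g: "stage_dominated C g"
  shows "integrable (stage_marginal x \<pi> t) (\<lambda>p. g (fst p) (snd p))"
proof (rule Bochner_Integration.integrable_bound)
  show "integrable (stage_marginal x \<pi> t) (\<lambda>p. C * w (fst p))"
    by (intro integrable_mult_right integrable_stage_weight assms)
  show "(\<lambda>p. g (fst p) (snd p)) \<in> borel_measurable (stage_marginal x \<pi> t)"
    using measurable_stage_dominated[OF g] by (simp add: measurable_cong_sets[OF sets_stage_marginal refl])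
  show "AE p in stage_marginal x \<pi> t. norm (g (fst p) (snd p)) \<le> norm (C * w (fst p))"
    using g by (intro AE_I2) (auto simp: stage_dominated_def dominated_def intro: order_trans[OF _ abs_ge_self])
qed

lemma stage_mean_diff:
  assumes "stage_dominated C g" "stage_dominated D h"
  shows "stage_mean x \<pi> t (\<lambda>y a. g y a - h y a) = stage_mean x \<pi> t g - stage_mean x \<pi> t h"
proof (cases "discount P ^ t = 0")
  case False
  then show ?thesis
    using integrable_stage_marginal[OF False assms(1)] integrable_stage_marginal[OF False assms(2)]
    by (simp add: stage_mean_def algebra_simps)
qed (simp add: stage_mean_eq_0 del: power_eq_0_iff)

lemma stage_mean_mono:
  assumes "stage_dominated C g" "stage_dominated D h"
    and "\<And>y a. y \<in> states P \<Longrightarrow> g y a \<le> h y a"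
  shows "stage_mean x \<pi> t g \<le> stage_mean x \<pi> t h"
proof (cases "discount P ^ t = 0")
  case False
  then show ?thesis
    unfolding stage_mean_def using assms(3) discount_nonneg
    by (intro mult_left_mono integral_mono integrable_stage_marginal[OF False assms(1)]
        integrable_stage_marginal[OF False assms(2)]) auto
qed (simp add: stage_mean_eq_0 del: power_eq_0_iff)

lemma stage_mean_abs_le:
  assumes g: "stage_dominated C g"
  shows "stage_mean x \<pi> t (\<lambda>y a. \<bar>g y a\<bar>) \<le> C * \<gamma> ^ t * w x"
proof -
  have C: "0 \<le> C" using g x dominated_constant_nonneg by (auto simp: stage_dominated_def)
  have "stage_mean x \<pi> t (\<lambda>y a. \<bar>g y a\<bar>) \<le> stage_mean x \<pi> t (\<lambda>y a. C * w y)"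
    using g dominated_weight[OF C]
    by (intro stage_mean_mono[of C _ C]) (auto simp: stage_dominated_def intro: dominated_abs dest: dominatedD)
  also have "\<dots> = C * stage_mean x \<pi> t (\<lambda>y a. w y)" by (simp add: stage_mean_def)
  also have "\<dots> \<le> C * (\<gamma> ^ t * w x)" by (intro mult_left_mono stage_mean_weight_le C)
  finally show ?thesis by (simp add: mult.assoc)
qed

lemma abs_stage_mean_le:
  assumes g: "stage_dominated C g"
  shows "\<bar>stage_mean x \<pi> t g\<bar> \<le> C * \<gamma> ^ t * w x"
proof -
  have "\<bar>stage_mean x \<pi> t g\<bar> \<le> stage_mean x \<pi> t (\<lambda>y a. \<bar>g y a\<bar>)"
    unfolding stage_mean_def using discount_nonneg by (simp add: abs_mult mult_left_mono)
  also note stage_mean_abs_le[OF g]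
  finally show ?thesis .
qed

lemma summable_stage_bound: "summable (\<lambda>t. C * \<gamma> ^ t * w x)"
  using \<gamma>_nonneg \<gamma>_less_1 by (intro summable_mult2 summable_mult summable_geometric) auto

lemma summable_stage_mean:
  assumes g: "stage_dominated C g"
  shows "summable (\<lambda>t. stage_mean x \<pi> t g)"
  using abs_stage_mean_le[OF g] by (intro summable_comparison_test[OF _ summable_stage_bound[of C]]) auto

lemma stage_mean_tendsto_0:
  assumes g: "stage_dominated C g"
  shows "(\<lambda>t. stage_mean x \<pi> t g) \<longlonglongrightarrow> 0"
  by (rule summable_LIMSEQ_zero[OF summable_stage_mean[OF g]])

lemma stage_mean_0:
  assumes u: "dominated C u"
  shows "stage_mean x \<pi> 0 (\<lambda>y a. u y) = u x"
proof -
  have "(\<integral>p. u (fst p) \<partial>stage_marginal x \<pi> 0)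
      = (\<integral>z. u z \<partial>distr (stage_marginal x \<pi> 0) (state_space P) fst)"
    using dominatedD(1)[OF u] by (intro integral_distr[symmetric]) auto
  then show ?thesis
    using x dominatedD(1)[OF u]
    by (simp add: stage_mean_def distr_stage_marginal_0_fst[OF x \<pi>] integral_return)
qed

text \<open>The recursion of the marginals is available for nonnegative integrals. For nonnegative
  dominated functions these are finite and convert to real ones, and linearity extends the identity
  to signed \<open>u\<close>.\<close>

lemma stage_mean_Suc:
  assumes u: "dominated C u"
  shows "stage_mean x \<pi> (Suc t) (\<lambda>y a. u y) = stage_mean x \<pi> t (\<lambda>y a. transition a u y)"
proof (cases "discount P = 0")
  case True
  then show ?thesis by (simp add: stage_mean_def transition_def)
next
  case b: False
  have C: "0 \<le> C" by (rule dominated_constant_nonneg[OF u x])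
  have nonneg: "stage_mean x \<pi> (Suc t) (\<lambda>y a. v y) = stage_mean x \<pi> t (\<lambda>y a. transition a v y)"
    if v: "dominated D v" "\<And>y. y \<in> states P \<Longrightarrow> 0 \<le> v y" for D v
  proof -
    let ?K = "\<lambda>p. \<integral>z. v z \<partial>kernel P (snd p) (fst p)"
    have K: "ennreal (?K p) = (\<integral>\<^sup>+ z. ennreal (v z) \<partial>kernel P (snd p) (fst p))" "0 \<le> ?K p"
      if "fst p \<in> states P" for p
    proof -
      have "0 \<le> v z" if "z \<in> space (kernel P (snd p) (fst p))" for z
        using v(2) kernelD(3)[OF \<open>fst p \<in> states P\<close>] that by simp
      then show "ennreal (?K p) = (\<integral>\<^sup>+ z. ennreal (v z) \<partial>kernel P (snd p) (fst p))" "0 \<le> ?K p"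
        by (auto intro!: nn_integral_eq_integral[symmetric] integrable_kernel[OF b that v(1)]
            Bochner_Integration.integral_nonneg AE_I2)
    qed
    have v_stage: "stage_dominated D (\<lambda>y a. v y)" using v by (simp add: stage_dominated_def)
    have "integrable (stage_marginal x \<pi> t) (\<lambda>p. transition (snd p) v (fst p))"
      using b by (intro integrable_stage_marginal[OF _ stage_dominated_transition[OF v(1)]]) auto
    then have intK: "integrable (stage_marginal x \<pi> t) ?K" using b by (simp add: transition_def)
    have "ennreal (\<integral>p. v (fst p) \<partial>stage_marginal x \<pi> (Suc t))
        = (\<integral>\<^sup>+ p. ennreal (v (fst p)) \<partial>stage_marginal x \<pi> (Suc t))"
      using v b by (intro nn_integral_eq_integral[symmetric] integrable_stage_marginal[OF _ v_stage] AE_I2) auto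
    also have "\<dots> = (\<integral>\<^sup>+ p. (\<integral>\<^sup>+ z. ennreal (v z) \<partial>kernel P (snd p) (fst p)) \<partial>stage_marginal x \<pi> t)"
      using dominatedD(1)[OF v(1)] by (intro nn_integral_stage_marginal_Suc) simp
    also have "\<dots> = (\<integral>\<^sup>+ p. ennreal (?K p) \<partial>stage_marginal x \<pi> t)"
      using K by (intro nn_integral_cong) auto
    also have "\<dots> = ennreal (\<integral>p. ?K p \<partial>stage_marginal x \<pi> t)"
      using K by (intro nn_integral_eq_integral[OF intK] AE_I2) auto
    finally have "ennreal (\<integral>p. v (fst p) \<partial>stage_marginal x \<pi> (Suc t))
        = ennreal (\<integral>p. ?K p \<partial>stage_marginal x \<pi> t)" .
    moreover have "0 \<le> (\<integral>p. v (fst p) \<partial>stage_marginal x \<pi> (Suc t))"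
      by (rule Bochner_Integration.integral_nonneg) (use v(2) in auto)
    moreover have "0 \<le> (\<integral>p. ?K p \<partial>stage_marginal x \<pi> t)"
      by (rule Bochner_Integration.integral_nonneg) (use K(2) in auto)
    ultimately have "(\<integral>p. v (fst p) \<partial>stage_marginal x \<pi> (Suc t)) = (\<integral>p. ?K p \<partial>stage_marginal x \<pi> t)"
      by simp
    then show ?thesis by (simp add: stage_mean_def transition_def)
  qed
  \<comment> \<open>\<open>u\<close> is a difference of two nonnegative dominated functions.\<close>
  define v where "v y = u y + C * w y" for y
  have v: "dominated (C + C) v"
    using dominated_add[OF u dominated_weight[OF C]] by (simp add: v_def[abs_def])
  have v0: "0 \<le> v y" if "y \<in> states P" for y
    using dominatedD(2)[OF u that] by (simp add: v_def abs_le_iff)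
  have cw: "dominated C (\<lambda>y. C * w y)" "\<And>y. y \<in> states P \<Longrightarrow> 0 \<le> C * w y"
    using dominated_weight[OF C] w_nonneg C by auto
  have u_eq: "u = (\<lambda>y. v y - C * w y)" by (simp add: v_def)
  have "stage_mean x \<pi> (Suc t) (\<lambda>y a. u y)
      = stage_mean x \<pi> (Suc t) (\<lambda>y a. v y) - stage_mean x \<pi> (Suc t) (\<lambda>y a. C * w y)"
    using v cw unfolding u_eq by (intro stage_mean_diff[where C="C + C" and D=C]) (auto simp: stage_dominated_def)
  also have "\<dots> = stage_mean x \<pi> t (\<lambda>y a. transition a v y) - stage_mean x \<pi> t (\<lambda>y a. transition a (\<lambda>y. C * w y) y)"
    using nonneg[OF v v0] nonneg[OF cw] by simp
  also have "\<dots> = stage_mean x \<pi> t (\<lambda>y a. transition a v y - transition a (\<lambda>y. C * w y) y)"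
    by (rule stage_mean_diff[symmetric, OF stage_dominated_transition[OF v] stage_dominated_transition[OF cw(1)]])
  also have "\<dots> = stage_mean x \<pi> t (\<lambda>y a. transition a u y)"
    unfolding stage_mean_def using transition_diff[OF v cw(1)]
    by (intro arg_cong2[where f="(*)"] Bochner_Integration.integral_cong refl) (auto simp: u_eq[symmetric])
  finally show ?thesis .
qed

text \<open>The expected absolute values of the terms are at most
  \<open>C * \<gamma> ^ t * w x\<close>, hence summable. The random series therefore converges
  absolutely almost surely, and sum and expectation may be exchanged.\<close>

lemma discounted_total_eq_suminf:
  assumes g: "stage_dominated C g"
  shows "discounted_total P g x \<pi> = (\<Sum>t. stage_mean x \<pi> t g)"
proof -
  let ?T = "trajectory_law P x \<pi>"
  let ?f = "\<lambda>t \<omega>. discount P ^ t * g (fst (\<omega> t)) (snd (\<omega> t))"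
  note comp = measurable_trajectory_component[OF x \<pi>]
  have eq: "(\<integral>\<omega>. h (fst (\<omega> t)) (snd (\<omega> t)) \<partial>?T) = (\<integral>p. h (fst p) (snd p) \<partial>stage_marginal x \<pi> t)"
    if "stage_dominated C h" for h t
    unfolding stage_marginal_def using integral_distr[OF comp measurable_stage_dominated[OF that]] by simp
  have int: "integrable ?T (?f t)" for t
  proof (cases "discount P ^ t = 0")
    case False
    have "integrable ?T (\<lambda>\<omega>. g (fst (\<omega> t)) (snd (\<omega> t)))"
      using integrable_stage_marginal[OF False g] integrable_distr_eq[OF comp measurable_stage_dominated[OF g]]
      by (simp add: stage_marginal_def)
    then show ?thesis by simp
  qed simp
  have abs_g: "stage_dominated C (\<lambda>y a. \<bar>g y a\<bar>)"
    using g by (auto simp: stage_dominated_def intro: dominated_abs)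
  have mean: "(\<integral>\<omega>. ?f t \<omega> \<partial>?T) = stage_mean x \<pi> t g" for t
    by (simp add: stage_mean_def eq[OF g])
  have norm_mean: "(\<integral>\<omega>. norm (?f t \<omega>) \<partial>?T) = stage_mean x \<pi> t (\<lambda>y a. \<bar>g y a\<bar>)" for t
    using discount_nonneg by (simp add: stage_mean_def eq[OF abs_g] abs_mult)
  have sum: "summable (\<lambda>t. \<integral>\<omega>. norm (?f t \<omega>) \<partial>?T)"
    unfolding norm_mean by (rule summable_stage_mean[OF abs_g])
  have int_norm: "integrable ?T (\<lambda>\<omega>. norm (?f t \<omega>))" for t
    by (rule integrable_norm[OF int])
  have meas: "(\<lambda>\<omega>. ennreal (norm (?f t \<omega>))) \<in> borel_measurable ?T" for t
    by (rule measurable_compose[OF borel_measurable_integrable[OF int_norm] measurable_ennreal])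
  have "(\<integral>\<^sup>+ \<omega>. (\<Sum>t. ennreal (norm (?f t \<omega>))) \<partial>?T) = (\<Sum>t. \<integral>\<^sup>+ \<omega>. ennreal (norm (?f t \<omega>)) \<partial>?T)"
    by (rule nn_integral_suminf[OF meas])
  also have "\<dots> = (\<Sum>t. ennreal (\<integral>\<omega>. norm (?f t \<omega>) \<partial>?T))"
    by (intro suminf_cong nn_integral_eq_integral int_norm) auto
  also have "\<dots> < \<infinity>"
    using sum by (subst suminf_ennreal_eq[OF _ summable_sums[OF sum]]) (auto intro!: integral_nonneg_AE)
  finally have "AE \<omega> in ?T. (\<Sum>t. ennreal (norm (?f t \<omega>))) \<noteq> \<infinity>"
    using meas by (intro nn_integral_PInf_AE borel_measurable_suminf_order) auto
  then have "AE \<omega> in ?T. summable (\<lambda>t. norm (?f t \<omega>))"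
    by (rule AE_mp) (auto intro!: AE_I2 summable_suminf_not_top)
  then have "(\<integral>\<omega>. (\<Sum>t. ?f t \<omega>) \<partial>?T) = (\<Sum>t. \<integral>\<omega>. ?f t \<omega> \<partial>?T)"
    using int sum by (intro integral_suminf) auto
  then show ?thesis unfolding discounted_total_def mean .
qed

lemma discounted_total_diff:
  assumes g: "stage_dominated C g" and h: "stage_dominated D h"
  shows "discounted_total P (\<lambda>y a. g y a - k * h y a) x \<pi>
    = discounted_total P g x \<pi> - k * discounted_total P h x \<pi>"
proof -
  have kh: "stage_dominated (\<bar>k\<bar> * D) (\<lambda>y a. k * h y a)"
    using h by (auto simp: stage_dominated_def intro: dominated_cmult)
  have diff: "stage_dominated (C + \<bar>k\<bar> * D) (\<lambda>y a. g y a - k * h y a)"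
    using g kh dominated_diff by (auto simp: stage_dominated_def)
  have "stage_mean x \<pi> t (\<lambda>y a. g y a - k * h y a) = stage_mean x \<pi> t g - k * stage_mean x \<pi> t h" for t
    unfolding stage_mean_diff[OF g kh] by (simp add: stage_mean_def)
  then show ?thesis
    unfolding discounted_total_eq_suminf[OF g] discounted_total_eq_suminf[OF h] discounted_total_eq_suminf[OF diff]
    using summable_stage_mean[OF g] summable_stage_mean[OF h]
    by (simp add: suminf_diff[symmetric] suminf_mult summable_mult)
qed

text \<open>Each term is the difference of consecutive discounted means of \<open>u\<close>, and
  these tend to 0. The total does not depend on the policy, which is what makes verification
  work.\<close>

lemma stage_mean_telescope_sums:
  assumes u: "dominated D u"
  shows "(\<lambda>t. stage_mean x \<pi> t (\<lambda>y a. u y - transition a u y)) sums u x"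
proof -
  have us: "stage_dominated D (\<lambda>y a. u y)" using u by (simp add: stage_dominated_def)
  have "stage_mean x \<pi> t (\<lambda>y a. u y - transition a u y)
      = stage_mean x \<pi> t (\<lambda>y a. u y) - stage_mean x \<pi> (Suc t) (\<lambda>y a. u y)" for t
    unfolding stage_mean_Suc[OF u] by (rule stage_mean_diff[OF us stage_dominated_transition[OF u]])
  then show ?thesis
    using telescope_sums'[OF stage_mean_tendsto_0[OF us]] by (simp add: stage_mean_0[OF u])
qed

text \<open>The hypothesis bounds \<open>g\<close> stage by stage by
  \<open>u y - transition a u y\<close>, whose discounted total is \<open>u x\<close> under every
  policy.\<close>

lemma discounted_total_le:
  assumes g: "stage_dominated C g" and u: "dominated D u"
    and le: "\<And>y a. y \<in> states P \<Longrightarrow> g y a + transition a u y \<le> u y"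
  shows "discounted_total P g x \<pi> \<le> u x"
proof -
  have h: "stage_dominated (D + D * \<gamma>) (\<lambda>y a. u y - transition a u y)"
    using dominated_diff[OF u] stage_dominated_transition[OF u] by (auto simp: stage_dominated_def)
  have "stage_mean x \<pi> t g \<le> stage_mean x \<pi> t (\<lambda>y a. u y - transition a u y)" for t
    using le by (intro stage_mean_mono[OF g h]) (simp add: le_diff_eq)
  then have "(\<Sum>t. stage_mean x \<pi> t g) \<le> u x"
    by (intro sums_le[OF _ summable_sums[OF summable_stage_mean[OF g]] stage_mean_telescope_sums[OF u]])
  then show ?thesis by (simp add: discounted_total_eq_suminf[OF g])
qed

end

end

section \<open>Stationary policies and dynamic programming\<close>

context weighted_project
begin

lemma stage_mean_stationary:
  assumes x: "x \<in> states P" and \<sigma>: "\<sigma> \<in> state_space P \<rightarrow>\<^sub>M count_space UNIV"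
    and g: "stage_dominated C g"
  shows "stage_mean x (stationary_policy \<sigma>) t g = stage_mean x (stationary_policy \<sigma>) t (\<lambda>y a. g y (\<sigma> y))"
proof -
  have g\<sigma>: "stage_dominated C (\<lambda>y a. g y (\<sigma> y))"
    using dominated_action[OF g \<sigma>] by (simp add: stage_dominated_def)
  have "(\<integral>p. g (fst p) (snd p) \<partial>stage_marginal x (stationary_policy \<sigma>) t)
      = (\<integral>p. g (fst p) (\<sigma> (fst p)) \<partial>stage_marginal x (stationary_policy \<sigma>) t)"
  proof (rule integral_cong_AE)
    show "AE p in stage_marginal x (stationary_policy \<sigma>) t. g (fst p) (snd p) = g (fst p) (\<sigma> (fst p))"
      using AE_stage_marginal_stationary[OF x \<sigma>, of t] by eventually_elim simp
  qed (use measurable_stage_dominated[OF g] measurable_stage_dominated[OF g\<sigma>] in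
      \<open>simp_all add: measurable_cong_sets[OF sets_stage_marginal refl]\<close>)
  then show ?thesis by (simp add: stage_mean_def)
qed

text \<open>The telescoping sum again, with equality required only at the actions of
  \<open>\<sigma>\<close>: almost surely no others are taken.\<close>

lemma discounted_total_stationary_eq:
  assumes x: "x \<in> states P" and \<sigma>: "\<sigma> \<in> state_space P \<rightarrow>\<^sub>M count_space UNIV"
    and g: "stage_dominated C g" and u: "dominated D u"
    and eq: "\<And>y. y \<in> states P \<Longrightarrow> g y (\<sigma> y) + transition (\<sigma> y) u y = u y"
  shows "discounted_total P g x (stationary_policy \<sigma>) = u x"
proof -
  let ?\<pi> = "stationary_policy \<sigma>"
  have \<pi>: "?\<pi> \<in> policies P" by (rule stationary_policy_in_policies[OF \<sigma>])
  have h: "stage_dominated (D + D * \<gamma>) (\<lambda>y a. u y - transition a u y)"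
    using dominated_diff[OF u] stage_dominated_transition[OF u] by (auto simp: stage_dominated_def)
  have "stage_mean x ?\<pi> t g = stage_mean x ?\<pi> t (\<lambda>y a. u y - transition a u y)" for t
  proof -
    have "stage_mean x ?\<pi> t (\<lambda>y a. g y (\<sigma> y)) = stage_mean x ?\<pi> t (\<lambda>y a. u y - transition (\<sigma> y) u y)"
      unfolding stage_mean_def using eq
      by (intro arg_cong2[where f="(*)"] Bochner_Integration.integral_cong refl) (auto simp: eq_diff_eq)
    then show ?thesis
      using stage_mean_stationary[OF x \<sigma> g] stage_mean_stationary[OF x \<sigma> h] by simp
  qed
  then show ?thesis
    using sums_unique[OF stage_mean_telescope_sums[OF x \<pi> u]] by (simp add: discounted_total_eq_suminf[OF x \<pi> g])
qed

section \<open>Continuity of stationary values in the decision rule\<close>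

definition stationary_step :: "(real \<Rightarrow> bool) \<Rightarrow> (real \<Rightarrow> real) \<Rightarrow> real \<Rightarrow> real" where
  "stationary_step \<sigma> u y = transition (\<sigma> y) u y"

lemma dominated_stationary_step:
  assumes "\<sigma> \<in> state_space P \<rightarrow>\<^sub>M count_space UNIV" "dominated D u"
  shows "dominated (D * \<gamma>) (stationary_step \<sigma> u)"
  using dominated_action[OF stage_dominated_transition[OF assms(2)] assms(1)]
  by (simp add: stationary_step_def[abs_def])

lemma dominated_stationary_steps:
  assumes "\<sigma> \<in> state_space P \<rightarrow>\<^sub>M count_space UNIV" "dominated D u"
  shows "dominated (D * \<gamma> ^ t) ((stationary_step \<sigma> ^^ t) u)"
proof (induction t)
  case (Suc t)
  then show ?case using dominated_stationary_step[OF assms(1) Suc] by (simp add: ac_simps)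
qed (simp add: assms)

text \<open>The dependence on \<open>\<sigma>\<close> moves from the marginal to the integrand,
  where limits can be taken pointwise. Each induction step strips off the last transition, so
  \<open>u\<close> has to stay arbitrary.\<close>

lemma stage_mean_stationary_steps:
  assumes x: "x \<in> states P" and \<sigma>: "\<sigma> \<in> state_space P \<rightarrow>\<^sub>M count_space UNIV" and u: "dominated D u"
  shows "stage_mean x (stationary_policy \<sigma>) t (\<lambda>y a. u y) = (stationary_step \<sigma> ^^ t) u x"
  using u
proof (induction t arbitrary: u D)
  case 0
  then show ?case by (simp add: stage_mean_0[OF x stationary_policy_in_policies[OF \<sigma>]])
next
  case (Suc t)
  have "stage_mean x (stationary_policy \<sigma>) (Suc t) (\<lambda>y a. u y)
      = stage_mean x (stationary_policy \<sigma>) t (\<lambda>y a. transition a u y)"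
    by (rule stage_mean_Suc[OF x stationary_policy_in_policies[OF \<sigma>] Suc.prems])
  also have "\<dots> = stage_mean x (stationary_policy \<sigma>) t (\<lambda>y a. stationary_step \<sigma> u y)"
    unfolding stationary_step_def by (rule stage_mean_stationary[OF x \<sigma> stage_dominated_transition[OF Suc.prems]])
  also have "\<dots> = (stationary_step \<sigma> ^^ Suc t) u x"
    unfolding Suc.IH[OF dominated_stationary_step[OF \<sigma> Suc.prems]] by (simp add: funpow_swap1)
  finally show ?case .
qed

text \<open>The rules converge pointwise in the state, without uniformity. At a given
  \<open>y\<close> the kernel is eventually that of the action \<open>\<sigma> y\<close>, so
  dominated convergence carries the iterates to the limit. The bound
  \<open>C * \<gamma> ^ t * w x\<close> is independent of \<open>n\<close>, so Tannery's theorem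
  handles the sum over time.\<close>

lemma discounted_total_stationary_tendsto:
  assumes x: "x \<in> states P"
    and s: "\<And>n. s n \<in> state_space P \<rightarrow>\<^sub>M count_space UNIV" and \<sigma>: "\<sigma> \<in> state_space P \<rightarrow>\<^sub>M count_space UNIV"
    and lim: "\<And>y. y \<in> states P \<Longrightarrow> \<forall>\<^sub>F n in sequentially. s n y = \<sigma> y"
    and g: "stage_dominated C g"
  shows "(\<lambda>n. discounted_total P g x (stationary_policy (s n))) \<longlonglongrightarrow> discounted_total P g x (stationary_policy \<sigma>)"
proof -
  define a where "a \<tau> t y = (stationary_step \<tau> ^^ t) (\<lambda>y. g y (\<tau> y)) y" for \<tau> t y
  have a_dom: "dominated (C * \<gamma> ^ t) (a \<tau> t)" if "\<tau> \<in> state_space P \<rightarrow>\<^sub>M count_space UNIV" for \<tau> t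
    unfolding a_def[abs_def] by (rule dominated_stationary_steps[OF that dominated_action[OF g that]])
  have total: "discounted_total P g x (stationary_policy \<tau>) = (\<Sum>t. a \<tau> t x)"
    if \<tau>: "\<tau> \<in> state_space P \<rightarrow>\<^sub>M count_space UNIV" for \<tau>
    unfolding discounted_total_eq_suminf[OF x stationary_policy_in_policies[OF \<tau>] g]
      stage_mean_stationary[OF x \<tau> g] stage_mean_stationary_steps[OF x \<tau> dominated_action[OF g \<tau>]] a_def ..
  have a_lim: "(\<lambda>n. a (s n) t y) \<longlonglongrightarrow> a \<sigma> t y" if "y \<in> states P" for t y
    using that
  proof (induction t arbitrary: y)
    case 0
    then show ?case
      unfolding a_def by (intro tendsto_eventually eventually_mono[OF lim]) auto
  next
    case (Suc t)
    have "(\<lambda>n. transition (\<sigma> y) (a (s n) t) y) \<longlonglongrightarrow> transition (\<sigma> y) (a \<sigma> t) y"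
      by (rule transition_tendsto[OF a_dom[OF s] a_dom[OF \<sigma>] Suc.IH Suc.prems])
    moreover have "\<forall>\<^sub>F n in sequentially. transition (\<sigma> y) (a (s n) t) y = a (s n) (Suc t) y"
      using lim[OF Suc.prems] by eventually_elim (simp add: a_def[abs_def] stationary_step_def)
    ultimately have "(\<lambda>n. a (s n) (Suc t) y) \<longlonglongrightarrow> transition (\<sigma> y) (a \<sigma> t) y"
      by (rule Lim_transform_eventually)
    then show ?case by (simp add: a_def[abs_def] stationary_step_def)
  qed
  have "(\<lambda>n. \<Sum>t. a (s n) t x) \<longlonglongrightarrow> (\<Sum>t. a \<sigma> t x)"
  proof (rule tannerys_theorem[THEN conjunct2, THEN conjunct2])
    show "\<forall>\<^sub>F (t, n) in at_top \<times>\<^sub>F sequentially. norm (a (s n) t x) \<le> C * \<gamma> ^ t * w x"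
      using dominatedD(2)[OF a_dom[OF s] x] by (auto intro!: always_eventually)
    show "summable (\<lambda>t. C * \<gamma> ^ t * w x)"
      by (rule summable_stage_bound[OF x stationary_policy_in_policies[OF \<sigma>]])
  qed (use a_lim[OF x] in auto)
  then show ?thesis using s \<sigma> by (simp add: total)
qed

section \<open>Bellman operator and value iteration\<close>

definition bellman :: "(real \<Rightarrow> bool \<Rightarrow> real) \<Rightarrow> (real \<Rightarrow> real) \<Rightarrow> real \<Rightarrow> real" where
  "bellman g u y = max (g y True + transition True u y) (g y False + transition False u y)"

lemma dominated_bellman:
  assumes g: "stage_dominated C g" and u: "dominated D u"
  shows "dominated (C + D * \<gamma>) (bellman g u)"
proof -
  have "dominated (C + D * \<gamma>) (\<lambda>y. g y a + transition a u y)" for a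
    using g stage_dominated_transition[OF u] by (intro dominated_add) (auto simp: stage_dominated_def)
  from this[of True] this[of False] show ?thesis
    by (auto simp: dominated_def bellman_def[abs_def] max_def)
qed

lemma bellman_contraction:
  assumes u: "dominated C u" and v: "dominated D v" and d: "dominated E (\<lambda>z. u z - v z)"
    and y: "y \<in> states P"
  shows "\<bar>bellman g u y - bellman g v y\<bar> \<le> E * \<gamma> * w y"
proof -
  have "\<bar>transition a u y - transition a v y\<bar> \<le> E * \<gamma> * w y" for a
    using abs_transition_le[OF d y, of a] transition_diff[OF u v y, of a] by simp
  from this[of True] this[of False] show ?thesis
    unfolding bellman_def by linarith
qed

lemma bellman_tendsto:
  assumes "\<And>n. dominated C (u n)" "dominated D v"
    "\<And>z. z \<in> states P \<Longrightarrow> (\<lambda>n. u n z) \<longlonglongrightarrow> v z" "y \<in> states P"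
  shows "(\<lambda>n. bellman g (u n) y) \<longlonglongrightarrow> bellman g v y"
  unfolding bellman_def by (intro tendsto_intros transition_tendsto[OF assms])

text \<open>Value iteration from 0: successive differences shrink like \<open>\<gamma> ^ n\<close>
  in the weighted norm, so the iterates converge at every state.\<close>

lemma bellman_fixpoint:
  assumes g: "stage_dominated C g" and x: "x \<in> states P"
  obtains u D where "dominated D u" "\<And>y. y \<in> states P \<Longrightarrow> bellman g u y = u y"
proof -
  define U where "U n = (bellman g ^^ n) (\<lambda>_. 0)" for n
  \<comment> \<open>The solution of \<open>C + D * \<gamma> = D\<close>: the operator maps the ball
    of this radius into itself.\<close>
  define D where "D = C / (1 - \<gamma>)"
  \<comment> \<open>The state \<open>x\<close> shows that the state space is nonempty; over an empty
    one a negative \<open>C\<close> would be possible.\<close>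
  have C: "0 \<le> C" using g x dominated_constant_nonneg by (auto simp: stage_dominated_def)
  have D: "C + D * \<gamma> = D" "0 \<le> D" using C \<gamma>_less_1 by (auto simp: D_def field_simps)
  have U_Suc: "U (Suc n) = bellman g (U n)" for n by (simp add: U_def)
  have U_dom: "dominated D (U n)" for n
  proof (induction n)
    case 0
    then show ?case using D w_nonneg by (simp add: U_def dominated_def)
  next
    case (Suc n)
    then show ?case using dominated_bellman[OF g Suc] by (simp add: U_Suc D(1))
  qed
  have diff: "dominated (C * \<gamma> ^ n) (\<lambda>y. U (Suc n) y - U n y)" for n
  proof (induction n)
    case 0
    have "dominated (C + 0 * \<gamma>) (bellman g (\<lambda>_. 0))"
      by (rule dominated_bellman[OF g]) (simp add: dominated_def)
    then show ?case by (simp add: U_def)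
  next
    case (Suc n)
    have "(\<lambda>y. U (Suc (Suc n)) y - U (Suc n) y) \<in> borel_measurable (state_space P)"
      using U_dom by (intro borel_measurable_diff) (auto simp: dominated_def)
    then show ?case
      using bellman_contraction[OF U_dom U_dom Suc] by (auto simp: dominated_def U_Suc ac_simps)
  qed
  define u where "u y = lim (\<lambda>n. U n y)" for y
  have lim: "(\<lambda>n. U n y) \<longlonglongrightarrow> u y" if y: "y \<in> states P" for y
  proof -
    have "summable (\<lambda>n. C * \<gamma> ^ n * w y)"
      using \<gamma>_nonneg \<gamma>_less_1 by (intro summable_mult2 summable_mult summable_geometric) auto
    then have "summable (\<lambda>n. U (Suc n) y - U n y)"
      by (rule summable_comparison_test[rotated]) (use dominatedD(2)[OF diff y] in auto)
    then have "convergent (\<lambda>n. \<Sum>k<n. U (Suc k) y - U k y)"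
      by (simp add: summable_iff_convergent)
    moreover have "U 0 y = 0" by (simp add: U_def)
    ultimately have "convergent (\<lambda>n. U n y)"
      unfolding sum_lessThan_telescope[of "\<lambda>k. U k y"] by simp
    then show ?thesis by (simp add: u_def convergent_LIMSEQ_iff)
  qed
  have u: "dominated D u"
    unfolding dominated_def
  proof (intro conjI ballI)
    show "u \<in> borel_measurable (state_space P)"
      unfolding u_def[abs_def] using U_dom by (intro borel_measurable_lim_metric) (auto simp: dominated_def)
    show "\<bar>u y\<bar> \<le> D * w y" if y: "y \<in> states P" for y
      using dominatedD(2)[OF U_dom y] by (intro LIMSEQ_le_const2[OF tendsto_rabs[OF lim[OF y]]]) auto
  qed
  have "bellman g u y = u y" if y: "y \<in> states P" for y
    using bellman_tendsto[OF U_dom u lim y] LIMSEQ_Suc[OF lim[OF y]]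
    unfolding U_Suc by (rule LIMSEQ_unique)
  then show thesis using that u by blast
qed

end

section \<open>The optimality equation at a fixed price\<close>

locale admissible_project = weighted_project +
  fixes K :: real
  assumes reward_dominated: "stage_dominated K (reward P)"
    and cost_dominated: "stage_dominated K (cost P)"
begin

lemma net_dominated: "stage_dominated (K + \<bar>l\<bar> * K) (\<lambda>y a. reward P y a - l * cost P y a)"
  using reward_dominated cost_dominated
  by (auto simp: stage_dominated_def intro!: dominated_diff dominated_cmult)

lemma net_value_eq:
  assumes "x \<in> states P" "\<pi> \<in> policies P"
  shows "net_value P l x \<pi> = discounted_total P (\<lambda>y a. reward P y a - l * cost P y a) x \<pi>"
  unfolding net_value_def reward_metric_def cost_metric_def
  by (rule discounted_total_diff[symmetric, OF assms reward_dominated cost_dominated])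

context
  fixes x :: real and l :: real
  assumes x: "x \<in> states P"
begin

text \<open>A Bellman fixed point \<open>u\<close> bounds the value of every policy, and its greedy
  selector attains \<open>u\<close>. Hence the supremum is a maximum equal to \<open>u\<close> on
  the states, and it inherits measurability, domination and the equation.\<close>

lemma optimal_value_bellman:
  obtains D where "dominated D (optimal_value P l)"
    "\<And>y. y \<in> states P \<Longrightarrow> optimal_value P l y = max (action_value P l True y) (action_value P l False y)"
    "\<And>y \<pi>. y \<in> states P \<Longrightarrow> \<pi> \<in> policies P \<Longrightarrow> net_value P l y \<pi> \<le> optimal_value P l y"
proof -
  let ?g = "\<lambda>y a. reward P y a - l * cost P y a"
  obtain u D where u: "dominated D u" and fp: "\<And>y. y \<in> states P \<Longrightarrow> bellman ?g u y = u y"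
    using bellman_fixpoint[OF net_dominated x] by metis
  have le: "net_value P l y \<pi> \<le> u y" if "y \<in> states P" "\<pi> \<in> policies P" for y \<pi>
    unfolding net_value_eq[OF that]
  proof (rule discounted_total_le[OF that net_dominated u])
    show "?g z a + transition a u z \<le> u z" if "z \<in> states P" for z a
      using fp[OF that] by (cases a) (auto simp: bellman_def)
  qed
  \<comment> \<open>Ties go to the active action; the selector is measurable as a comparison of two
    measurable functions.\<close>
  define \<sigma> where "\<sigma> y \<longleftrightarrow> ?g y False + transition False u y \<le> ?g y True + transition True u y" for y
  have "(\<lambda>y. ?g y a + transition a u y) \<in> borel_measurable (state_space P)" for a
    using net_dominated stage_dominated_transition[OF u]
    by (intro borel_measurable_add) (auto simp: stage_dominated_def dominated_def)
  then have \<sigma>: "\<sigma> \<in> state_space P \<rightarrow>\<^sub>M count_space UNIV"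
    unfolding \<sigma>_def[abs_def] by measurable
  have eq: "net_value P l y (stationary_policy \<sigma>) = u y" if "y \<in> states P" for y
    unfolding net_value_eq[OF that stationary_policy_in_policies[OF \<sigma>]]
  proof (rule discounted_total_stationary_eq[OF that \<sigma> net_dominated u])
    show "?g z (\<sigma> z) + transition (\<sigma> z) u z = u z" if "z \<in> states P" for z
      using fp[OF that] by (cases "\<sigma> z") (auto simp: bellman_def \<sigma>_def)
  qed
  have opt: "optimal_value P l y = u y" if y: "y \<in> states P" for y
    unfolding optimal_value_def
    using le[OF y] eq[OF y] stationary_policy_in_policies[OF \<sigma>]
    by (intro cSup_eq_maximum) (auto simp: image_iff intro: bexI[of _ "stationary_policy \<sigma>"])
  have dom: "dominated D (optimal_value P l)"
    using u opt measurable_cong[of "state_space P" "optimal_value P l" u borel] by (simp add: dominated_def)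
  have tr: "transition a (optimal_value P l) y = transition a u y" if "y \<in> states P" for a y
    unfolding transition_def using kernelD(3)[OF that] opt
    by (intro arg_cong2[where f="(*)"] Bochner_Integration.integral_cong refl) auto
  have "optimal_value P l y = max (action_value P l True y) (action_value P l False y)" if "y \<in> states P" for y
    using fp[OF that] opt[OF that]
    unfolding action_value_def bellman_def transition_def[symmetric] tr[OF that] by simp
  then show thesis using that dom le opt by auto
qed

lemma net_value_le_optimal_value:
  "\<pi> \<in> policies P \<Longrightarrow> net_value P l x \<pi> \<le> optimal_value P l x"
  using optimal_value_bellman x by metis

text \<open>A selector of maximisers turns the optimality equation into the evaluation equation of
  its own stationary policy, however ties are broken.\<close>

lemma net_value_greedy:
  assumes \<sigma>: "\<sigma> \<in> state_space P \<rightarrow>\<^sub>M count_space UNIV"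
    and greedy: "\<And>y. y \<in> states P \<Longrightarrow> action_value P l (\<not> \<sigma> y) y \<le> action_value P l (\<sigma> y) y"
  shows "net_value P l x (stationary_policy \<sigma>) = optimal_value P l x"
proof -
  obtain D where D: "dominated D (optimal_value P l)"
    and max: "\<And>y. y \<in> states P \<Longrightarrow> optimal_value P l y = max (action_value P l True y) (action_value P l False y)"
    using optimal_value_bellman by metis
  show ?thesis
    unfolding net_value_eq[OF x stationary_policy_in_policies[OF \<sigma>]]
  proof (rule discounted_total_stationary_eq[OF x \<sigma> net_dominated D])
    show "reward P y (\<sigma> y) - l * cost P y (\<sigma> y) + transition (\<sigma> y) (optimal_value P l) y = optimal_value P l y"
      if "y \<in> states P" for y
      using greedy[OF that] max[OF that] by (cases "\<sigma> y") (auto simp: action_value_def transition_def)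
  qed
qed

end

end

section \<open>Continuity of the index and optimality of thresholds\<close>

text \<open>A jump would skip values. For \<open>c < f z\<close> some point left of \<open>z\<close>
  has a value above \<open>c\<close>, obtained if necessary from the midpoint of \<open>c\<close>
  and \<open>f z\<close>, and monotonicity keeps \<open>f\<close> above \<open>c\<close> to the
  right of that point; the other side is symmetric.\<close>

lemma isCont_of_mono_intermediate:
  fixes f :: "real \<Rightarrow> real"
  assumes f: "mono f"
    and ivt: "\<And>a b c. f a < c \<Longrightarrow> c < f b \<Longrightarrow> \<exists>d. f d = c"
  shows "isCont f z"
proof -
  have less: "s < t" if "f s < f t" for s t
    using that f by (meson leD monoD not_less)
  have "(f \<longlongrightarrow> f z) (at z)"
  proof (rule order_tendstoI)
    fix c assume c: "c < f z"
    obtain l where l: "l < z" "c < f l"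
    proof (cases "c < f (z - 1)")
      case False
      then obtain d where "f d = (c + f z) / 2" using ivt[of "z - 1" "(c + f z) / 2" z] c by auto
      then have "c < f d" "f d < f z" using c by auto
      then show thesis using that less by blast
    qed (auto intro: that[of "z - 1"])
    have "\<forall>\<^sub>F s in at z. l < s" by (rule order_tendstoD(1)[OF tendsto_ident_at l(1)])
    then show "\<forall>\<^sub>F s in at z. c < f s"
      by eventually_elim (use l(2) f in \<open>auto simp: mono_def intro: less_le_trans less_imp_le\<close>)
  next
    fix c assume c: "f z < c"
    obtain l where l: "z < l" "f l < c"
    proof (cases "f (z + 1) < c")
      case False
      then obtain d where "f d = (c + f z) / 2" using ivt[of z "(c + f z) / 2" "z + 1"] c by auto
      then have "f z < f d" "f d < c" using c by auto
      then show thesis using that less by blast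
    qed (auto intro: that[of "z + 1"])
    have "\<forall>\<^sub>F s in at z. s < l" by (rule order_tendstoD(2)[OF tendsto_ident_at l(1)])
    then show "\<forall>\<^sub>F s in at z. f s < c"
      by eventually_elim (use l(2) f in \<open>auto simp: mono_def intro: le_less_trans less_imp_le\<close>)
  qed
  then show ?thesis by (simp add: isCont_def)
qed

lemma is_project_admissible:
  assumes P: "is_project P"
  obtains w \<gamma> K where "admissible_project P w \<gamma> K"
proof -
  obtain w M \<gamma> where w: "w \<in> borel_measurable (state_space P)" "0 < M" "discount P \<le> \<gamma>" "\<gamma> < 1"
    "\<And>x. x \<in> states P \<Longrightarrow> 1 \<le> w x"
    "\<And>x a. x \<in> states P \<Longrightarrow> max \<bar>reward P x a\<bar> (cost P x a) \<le> M * w x"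
    "\<And>x a. x \<in> states P \<Longrightarrow>
      ennreal (discount P) * (\<integral>\<^sup>+ y. ennreal (w y) \<partial>kernel P a x) \<le> ennreal (\<gamma> * w x)"
    using P unfolding is_project_def by blast
  interpret weighted_project P w \<gamma>
    using P w by unfold_locales (auto simp: is_project_def)
  have "(\<lambda>y. reward P y a) \<in> borel_measurable (state_space P)"
    "(\<lambda>y. cost P y a) \<in> borel_measurable (state_space P)" for a
    using P by (auto simp: is_project_def state_space_def intro: borel_measurable_continuous_on_restrict)
  \<comment> \<open>The growth condition bounds \<open>cost\<close> from above only; nonnegativity
    turns this into a bound on its absolute value.\<close>
  moreover have "0 \<le> cost P y a" if "y \<in> states P" for y a
    using P that by (cases a) (auto simp: is_project_def intro: order_trans less_imp_le)
  ultimately have "stage_dominated M (reward P)" "stage_dominated M (cost P)"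
    using w(6) by (auto simp: stage_dominated_def dominated_def)
  then have "admissible_project P w \<gamma> M" by unfold_locales
  then show thesis by (rule that)
qed

lemma threshold_policy_eq: "threshold_policy (ereal z) = stationary_policy (\<lambda>y. z < y)"
  by (simp add: threshold_policy_def stationary_policy_def)

section \<open>Threshold policies and the index\<close>

context admissible_project
begin

lemma measurable_threshold: "(\<lambda>y. z < y) \<in> state_space P \<rightarrow>\<^sub>M count_space UNIV" for z :: real
  unfolding state_space_def by (intro measurable_restrict_space1) measurable

lemma threshold_in_policies: "threshold_policy (ereal z) \<in> policies P"
  unfolding threshold_policy_eq by (rule stationary_policy_in_policies[OF measurable_threshold])

text \<open>The policy is active strictly above its threshold. As thresholds decrease to
  \<open>t\<close>, the action at each fixed state is eventually that of the
  \<open>t\<close>-policy, including at the state \<open>t\<close> itself.\<close>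

lemma continuous_at_right_cost_threshold:
  assumes x: "x \<in> states P"
  shows "continuous (at_right t) (\<lambda>z. G_threshold P x (ereal z))"
  unfolding continuous_within
proof (rule tendsto_at_right_sequentially)
  show "t < t + 1" by simp
  fix s :: "nat \<Rightarrow> real"
  assume s: "\<And>n. t < s n" and lim: "s \<longlonglongrightarrow> t"
  have "\<forall>\<^sub>F n in sequentially. (s n < y) = (t < y)" for y
  proof (cases "t < y")
    case True
    then show ?thesis using order_tendstoD(2)[OF lim True] by (auto elim: eventually_mono)
  next
    case False
    then show ?thesis using s by (intro always_eventually allI) (use less_trans in auto)
  qed
  then show "(\<lambda>n. G_threshold P x (ereal (s n))) \<longlonglongrightarrow> G_threshold P x (ereal t)"
    unfolding threshold_policy_eq cost_metric_def
    by (rule discounted_total_stationary_tendsto[OF x measurable_threshold measurable_threshold _ cost_dominated])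
qed

lemma index_gap_sign:
  assumes "indexable_with P idx" "y \<in> states P"
  shows "0 < action_gap P l y \<longleftrightarrow> l < idx y" "action_gap P l y < 0 \<longleftrightarrow> idx y < l"
    "action_gap P l y = 0 \<longleftrightarrow> idx y = l"
proof -
  have "sgn (action_gap P l y) = sgn (idx y - l)" using assms by (auto simp: indexable_with_def)
  then show "0 < action_gap P l y \<longleftrightarrow> l < idx y" "action_gap P l y < 0 \<longleftrightarrow> idx y < l"
    "action_gap P l y = 0 \<longleftrightarrow> idx y = l"
    by (auto simp: sgn_if split: if_splits)
qed

context
  fixes idx :: "real \<Rightarrow> real"
  assumes thr: "thresholdable P" and ind: "indexable_with P idx"
begin

text \<open>At a price strictly between \<open>idx z\<close> and \<open>idx y\<close>, the gap would
  be negative at \<open>z\<close> and positive at \<open>y\<close>, which puts the threshold above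
  \<open>z\<close> and below \<open>y\<close> although \<open>y \<le> z\<close>.\<close>

lemma index_mono_on: "mono_on (states P) idx"
proof (rule mono_onI, rule ccontr)
  fix y z assume yz: "y \<in> states P" "z \<in> states P" "y \<le> z" and "\<not> idx y \<le> idx z"
  then obtain l where l: "idx z < l" "l < idx y" using dense by (metis not_le)
  obtain t where t: "\<And>v. v \<in> states P \<Longrightarrow> ereal v \<le> t \<Longrightarrow> action_gap P l v \<le> 0"
    "\<And>v. v \<in> states P \<Longrightarrow> t \<le> ereal v \<Longrightarrow> 0 \<le> action_gap P l v"
    using thr unfolding thresholdable_def by metis
  have "\<not> t \<le> ereal z" using t(2)[OF yz(2)] index_gap_sign(2)[OF ind yz(2), of l] l by auto
  moreover have "\<not> ereal y \<le> t" using t(1)[OF yz(1)] index_gap_sign(1)[OF ind yz(1), of l] l by auto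
  ultimately show False using yz(3) by (meson ereal_less_eq(3) linear order_trans)
qed

lemma index_intermediate_value:
  assumes ab: "a \<in> states P" "b \<in> states P" and c: "idx a < c" "c < idx b"
  shows "\<exists>d\<in>states P. idx d = c"
proof -
  obtain t where t: "\<And>v. v \<in> states P \<Longrightarrow> ereal v \<le> t \<Longrightarrow> action_gap P c v \<le> 0"
    "\<And>v. v \<in> states P \<Longrightarrow> t \<le> ereal v \<Longrightarrow> 0 \<le> action_gap P c v"
    using thr unfolding thresholdable_def by metis
  have at: "ereal a < t" using t(2)[OF ab(1)] index_gap_sign(2)[OF ind ab(1), of c] c by (meson not_le)
  have tb: "t < ereal b" using t(1)[OF ab(2)] index_gap_sign(1)[OF ind ab(2), of c] c by (meson not_le)
  \<comment> \<open>Strictly between two states, the threshold is finite and is itself a state, so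
    both halves of thresholdability apply to it and force a zero gap.\<close>
  obtain d where d: "t = ereal d" using at tb by (cases t) auto
  have mem: "d \<in> states P" using at tb ab unfolding d states_def
    by (auto intro: order_trans[of _ "ereal a" "ereal d"] order_trans[of "ereal d" "ereal b"])
  then have "action_gap P c d = 0" using t[OF mem] d by (intro antisym) auto
  then show ?thesis using index_gap_sign(3)[OF ind mem] mem by blast
qed

context
  fixes x
  assumes x: "x \<in> states P"
begin

text \<open>The monotone projection onto the state interval. The extended index is the index
  composed with it, so monotonicity and intermediate values carry over to the whole line. Since
  \<open>x\<close> is a state, an end that is crossed is finite.\<close>

definition nearest_state :: "real \<Rightarrow> real" where
  "nearest_state z = (if ereal z < lower_end P then real_of_ereal (lower_end P)
     else if upper_end P < ereal z then real_of_ereal (upper_end P) else z)"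

lemma extend_index_eq: "extend_index P idx z = idx (nearest_state z)"
  by (simp add: extend_index_def nearest_state_def)

lemma nearest_state:
  shows "nearest_state z \<in> states P" "y \<in> states P \<Longrightarrow> nearest_state y = y"
    "z \<le> z' \<Longrightarrow> nearest_state z \<le> nearest_state z'"
proof -
  have lx: "lower_end P \<le> ereal x" "ereal x \<le> upper_end P" using x by (auto simp: states_def)
  then show "nearest_state z \<in> states P" "y \<in> states P \<Longrightarrow> nearest_state y = y"
    "z \<le> z' \<Longrightarrow> nearest_state z \<le> nearest_state z'"
    unfolding nearest_state_def states_def
    by (cases "lower_end P"; cases "upper_end P"; auto)+
qed

lemma extend_index_mono: "mono (extend_index P idx)"
  unfolding extend_index_eq[abs_def]
  by (intro monoI mono_onD[OF index_mono_on] nearest_state)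

lemma isCont_extend_index: "isCont (extend_index P idx) z"
proof (rule isCont_of_mono_intermediate[OF extend_index_mono])
  fix a b c assume "extend_index P idx a < c" "c < extend_index P idx b"
  then obtain d where "d \<in> states P" "idx d = c"
    using index_intermediate_value[OF nearest_state(1) nearest_state(1)] unfolding extend_index_eq by blast
  then show "\<exists>d. extend_index P idx d = c"
    by (intro exI[of _ d]) (simp add: extend_index_eq nearest_state(2))
qed

text \<open>States with the same index value as \<open>z\<close> may lie on both sides of
  \<open>z\<close>. The gap vanishes there, so the cut at \<open>z\<close> is still greedy.\<close>

lemma threshold_optimal:
  "net_value P (extend_index P idx z) x (threshold_policy (ereal z)) = optimal_value P (extend_index P idx z) x"
  unfolding threshold_policy_eq
proof (rule net_value_greedy[OF x measurable_threshold])
  fix y assume y: "y \<in> states P"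
  let ?l = "extend_index P idx z"
  have idx: "idx y = extend_index P idx y" using y by (simp add: extend_index_eq nearest_state(2))
  show "action_value P ?l (\<not> z < y) y \<le> action_value P ?l (z < y) y"
  proof (cases "z < y")
    case True
    then have "?l \<le> idx y" unfolding idx by (intro monoD[OF extend_index_mono]) simp
    then have "\<not> action_gap P ?l y < 0" using index_gap_sign(2)[OF ind y] by simp
    then show ?thesis using True by (simp add: action_gap_def)
  next
    case False
    then have "idx y \<le> ?l" unfolding idx by (intro monoD[OF extend_index_mono]) simp
    then have "\<not> 0 < action_gap P ?l y" using index_gap_sign(1)[OF ind y] by simp
    then show ?thesis using False by (simp add: action_gap_def)
  qed
qed

text \<open>No order between \<open>s\<close> and \<open>t\<close> is assumed, so the swapped
  instance provides the lower bound as well.\<close>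

lemma threshold_increment_bound:
  "F_threshold P x (ereal t) - F_threshold P x (ereal s)
     \<le> extend_index P idx s * (G_threshold P x (ereal t) - G_threshold P x (ereal s))"
  using net_value_le_optimal_value[OF x threshold_in_policies, of "extend_index P idx s" t]
  unfolding threshold_optimal[symmetric] net_value_def by (simp add: algebra_simps)

end

end

end

theorem proposition2:
  fixes P :: project and idx :: "real \<Rightarrow> real" and x z1 z2 :: real
  assumes "is_project P"
    and "thresholdable P"
    and "indexable_with P idx"
    and "x \<in> states P"
    and "z1 < z2"
    and "bounded_variation_on {z1..z2} (\<lambda>z. G_threshold P x (ereal z))"
  shows "has_LS_integral (extend_index P idx) (\<lambda>z. G_threshold P x (ereal z)) z1 z2
           (F_threshold P x (ereal z2) - F_threshold P x (ereal z1))"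
proof -
  obtain w \<gamma> K where "admissible_project P w \<gamma> K"
    using is_project_admissible[OF assms(1)] .
  then interpret admissible_project P w \<gamma> K .
  note model = assms(2-4)
  show ?thesis
  proof (rule has_LS_integral_of_increment_bounds)
    show "z1 \<le> z2" using assms(5) by simp
    show "continuous_on {z1..z2} (extend_index P idx)"
      by (intro continuous_at_imp_continuous_on ballI isCont_extend_index[OF model])
    show "mono (extend_index P idx)" by (rule extend_index_mono[OF model])
    show "continuous (at_right t) (\<lambda>z. G_threshold P x (ereal z))" for t
      by (rule continuous_at_right_cost_threshold[OF assms(4)])
    fix s t
    show "F_threshold P x (ereal t) - F_threshold P x (ereal s)
        \<le> extend_index P idx s * (G_threshold P x (ereal t) - G_threshold P x (ereal s))"
      by (rule threshold_increment_bound[OF model])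
    show "extend_index P idx t * (G_threshold P x (ereal t) - G_threshold P x (ereal s))
        \<le> F_threshold P x (ereal t) - F_threshold P x (ereal s)"
      using threshold_increment_bound[OF model, of s t] by (simp add: algebra_simps)
  qed (rule assms(6))
qed

end
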